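(* Let $n\ge3$ and let $H_n=([n],[n],E_n)$ with $E_n=\{(i,i),(i,i+1): i\in[n]\}$, indices modulo $n$ in $\{1,\dots,n\}$. For every $\vec p\in\partial(H_n)$ there exist a vector $\vec d=(d_1,\dots,d_n)$ of positive integers with $d_j\le 2$ for all $j$ and $d_j=1$ for some $j$, and a $\vec d$-discrete family $\mathcal A\sim H_n$ such that $\mu(\mathcal A)=\vec p$ and $\mu(\bigcup_{A\in\mathcal A}A)=1$.
   Context: For a bigraph $H=([n],[m],E)$ with neighborhoods $\mathcal N_H(\cdot)$, equip $[0,1]^m$ with Lebesgue measure $\mu$. A family $\mathcal A=\{A_1,\dots,A_n\}$ of measurable subsets of $[0,1]^m$ conforms with $H$ ($\mathcal A\sim H$) if each $A_i=B_i\times[0,1]^{[m]\setminus\mathcal N_H(i)}$ with $B_i\subseteq[0,1]^{\mathcal N_H(i)}$ measurable; $\mu(\mathcal A)=(\mu(A_i))_i$. The interior $\mathcal I(H)$ is the set of $\vec p\in(0,1)^n$ with $\mu(\bigcap_i([0,1]^m\setminus A_i))>0$ for all $\mathcal A\sim H$ with $\mu(\mathcal A)=\vec p$; the boundary $\partial(H)$ is the set of $\vec p\in(0,1]^n$ such that $(1-\epsilon)\vec p\in\mathcal I(H)$ and $(1+\epsilon)\vec p\notin\mathcal I(H)$ for all $\epsilon\in(0,1)$. A set $A\subseteq[0,1]^m$ is $d$-discrete in dimension $j$ if there is a partition of $[0,1]$ into $d$ disjoint intervals $\Delta_1,\dots,\Delta_d$ and sets $S_1,\dots,S_d\subseteq[0,1]^{[m]\setminus\{j\}}$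 with $A=\bigcup_{k=1}^d S_k\times\Delta_k$ (the factor $\Delta_k$ placed in coordinate $j$). For $\vec d=(d_1,\dots,d_m)$, $A$ is $\vec d$-discrete if it is $d_j$-discrete in dimension $j$ for every $j$, and a family is $\vec d$-discrete if each of its members is. *)

theory Defs
  imports "HOL-Probability.Probability"
begin

text \<open>
  A bigraph \<open>([n],[m],E)\<close> with left vertices \<open>{1..n}\<close> and right vertices \<open>{1..m}\<close>.
  Points of \<open>[0,1]\<^sup>V\<close> are extensional functions, i.e. elements of \<open>V \<rightarrow>\<^sub>E {0..1}\<close>.
\<close>

record bigraph =
  nleft :: nat
  nright :: nat
  edges :: "(nat \<times> nat) set"

definition nbhd :: "bigraph \<Rightarrow> nat \<Rightarrow> nat set" where
  "nbhd H i = {j \<in> {1..nright H}. (i, j) \<in> edges H}"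

text \<open>
  The product \<open>\<sigma>\<close>-algebra of \<open>PiM\<close> is the Borel one; completing it gives the
  Lebesgue-measurable subsets of the cube.
\<close>

definition cube :: "nat set \<Rightarrow> (nat \<Rightarrow> real) measure" where
  "cube V = completion (\<Pi>\<^sub>M v\<in>V. restrict_space lborel {0..1})"

abbreviation bicube :: "bigraph \<Rightarrow> (nat \<Rightarrow> real) measure" where
  "bicube H \<equiv> cube {1..nright H}"

text \<open>
  The library's \<open>prod_emb I M K B\<close> is the cylinder \<open>B \<times> (\<Pi> i\<in>I - K. space (M i))\<close>.
\<close>

definition conforms :: "(nat \<Rightarrow> (nat \<Rightarrow> real) set) \<Rightarrow> bigraph \<Rightarrow> bool" (infix \<open>\<sim>\<^sub>c\<close> 50) where
  "A \<sim>\<^sub>c H \<longleftrightarrow> (\<forall>i\<in>{1..nleft H}. \<exists>B \<in> sets (cube (nbhd H i)).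
     A i = prod_emb {1..nright H} (\<lambda>_. restrict_space lborel {0..1}) (nbhd H i) B)"

text \<open>
  A vector in \<open>\<real>\<^sup>n\<close> is a function of which only the values on \<open>{1..n}\<close> matter.
  In \<open>bigraph_interior\<close>, the factor \<open>space (bicube H)\<close> in front of the intersection is
  redundant unless \<open>nleft H = 0\<close>.
\<close>

definition bigraph_interior :: "bigraph \<Rightarrow> (nat \<Rightarrow> real) set" where
  "bigraph_interior H = {p. p \<in> {1..nleft H} \<rightarrow> {0<..<1} \<and>
     (\<forall>A. A \<sim>\<^sub>c H \<and> (\<forall>i\<in>{1..nleft H}. measure (bicube H) (A i) = p i) \<longrightarrow>
        measure (bicube H)
          (space (bicube H) \<inter> (\<Inter>i\<in>{1..nleft H}. space (bicube H) - A i)) > 0)}"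

definition bigraph_boundary :: "bigraph \<Rightarrow> (nat \<Rightarrow> real) set" where
  "bigraph_boundary H = {p. p \<in> {1..nleft H} \<rightarrow> {0<..1} \<and>
     (\<forall>\<epsilon>\<in>{0<..<1}. (\<lambda>i. (1 - \<epsilon>) * p i) \<in> bigraph_interior H \<and>
                  (\<lambda>i. (1 + \<epsilon>) * p i) \<notin> bigraph_interior H)}"

definition discrete_in_dim :: "nat \<Rightarrow> nat \<Rightarrow> nat \<Rightarrow> (nat \<Rightarrow> real) set \<Rightarrow> bool" where
  "discrete_in_dim m d j A \<longleftrightarrow> (\<exists>\<Delta> S.
     (\<forall>k\<in>{1..d}. is_interval (\<Delta> k) \<and> \<Delta> k \<noteq> {}) \<and>
     disjoint_family_on \<Delta> {1..d} \<and> (\<Union>k\<in>{1..d}. \<Delta> k) = {0..1::real} \<and>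
     (\<forall>k\<in>{1..d}. S k \<subseteq> ({1..m} - {j}) \<rightarrow>\<^sub>E {0..1}) \<and>
     A = (\<Union>k\<in>{1..d}. {y(j := t) | y t. y \<in> S k \<and> t \<in> \<Delta> k}))"

definition discrete_set :: "nat \<Rightarrow> (nat \<Rightarrow> nat) \<Rightarrow> (nat \<Rightarrow> real) set \<Rightarrow> bool" where
  "discrete_set m d A \<longleftrightarrow> (\<forall>j\<in>{1..m}. discrete_in_dim m (d j) j A)"

definition discrete_family ::
    "bigraph \<Rightarrow> (nat \<Rightarrow> nat) \<Rightarrow> (nat \<Rightarrow> (nat \<Rightarrow> real) set) \<Rightarrow> bool" where
  "discrete_family H d A \<longleftrightarrow> (\<forall>i\<in>{1..nleft H}. discrete_set (nright H) d (A i))"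

text \<open>The successor of \<open>i\<close> modulo \<open>n\<close> with representatives \<open>{1..n}\<close> is \<open>i mod n + 1\<close>.\<close>

definition cyclic_bigraph :: "nat \<Rightarrow> bigraph" where
  "cyclic_bigraph n = \<lparr>nleft = n, nright = n,
     edges = (\<Union>i\<in>{1..n}. {(i, i), (i, i mod n + 1)})\<rparr>"

end

theory Submission
  imports Defs
begin

text \<open>
  Cutting the cycle at a vertex \<open>j\<close> leaves a path, for which Shearer's bound is tight: with
  \<open>t\<^sub>0 = 1\<close> and \<open>t\<^sub>i\<^sub>+\<^sub>1 = 1 - q\<^sub>j\<^sub>+\<^sub>i / t\<^sub>i\<close>, pairwise exclusive events cover the cube exactly when some \<open>t\<^sub>i\<close>
  with \<open>i \<le> n\<close> becomes nonpositive. If on the other hand all these numbers are positive for every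
  cut, no family can cover. Indeed, in a covering family one may restrict the first variable to two
  values without increasing any measure. The measures of the sets reachable from these two values
  along uncovered points give a chain of numbers going twice around the cycle, from 1 down to 0. A
  linear programming argument at each vertex shortens this chain until it either fits into one
  round, which contradicts positivity, or is a single round closed up by one complementary
  inequality, which a convexity argument excludes. Hence a boundary point has a cut with
  \<open>t\<^sub>n = 0\<close>, and the exclusive events of that cut form the required family.
\<close>

subsection \<open>Levels of the cut cycle\<close>

text \<open>On a cycle the points reachable from a value of the first variable must be compared with
  that same value at the end, so averaging over the variable loses the decisive information. Two
  values suffice because exactly two events involve this variable: their conditional measures form a
  random point of the plane, and some mixture of two attained points lies below its mean in both
  coordinates. The two weights then behave like slices of the first vertex. Likewise every other
  vertex meets just two events, which gives two linear constraints on the widths of its slices; with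
  three slices, one can always be emptied. The case that resists shortening is a chain closed by
  \<open>1 - q k \<le> u 0 * (1 - u m)\<close>: it does not start at 1, so comparison with the
  levels of a single cut is not enough, and the two adjacent cuts \<open>k\<close> and
  \<open>k + 1\<close> have to be combined.\<close>

fun level :: "(nat \<Rightarrow> real) \<Rightarrow> nat \<Rightarrow> nat \<Rightarrow> real" where
  "level q j 0 = 1"
| "level q j (Suc i) = 1 - q (j + i) / level q j i"

definition subcritical :: "nat \<Rightarrow> (nat \<Rightarrow> real) \<Rightarrow> bool" where
  "subcritical n q \<longleftrightarrow> (\<forall>j. \<forall>i\<le>n. 0 < level q j i)"

text \<open>The map from \<open>t\<close> to \<open>1 - q / t\<close> is monotone for positive
  \<open>t\<close>, and the levels satisfy all chain inequalities with equality; they are therefore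
  the smallest chain.\<close>

lemma level_le_chain:
  assumes "\<And>i. 0 \<le> q i" and "\<And>i. i < l \<Longrightarrow> 0 < level q j i"
    and "1 \<le> u 0" and "\<And>i. i < l \<Longrightarrow> u i * (1 - u (Suc i)) \<le> q (j + i)"
  shows "level q j l \<le> u l"
  using assms(2,4)
proof (induction l)
  case (Suc l)
  have l: "0 < level q j l" "level q j l \<le> u l"
    using Suc by auto
  have "1 - u (Suc l) \<le> q (j + l) / u l"
    using l Suc.prems(2)[of l] by (simp add: field_simps)
  also have "\<dots> \<le> q (j + l) / level q j l"
    using l assms(1) by (intro divide_left_mono) auto
  finally show ?case by simp
qed (use assms(3) in simp)

lemma subcritical_chain_pos:
  assumes "subcritical n q" and "\<And>i. 0 \<le> q i" and "l \<le> n"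
    and "1 \<le> u 0" and "\<And>i. i < l \<Longrightarrow> u i * (1 - u (Suc i)) \<le> q (j + i)"
  shows "0 < u l"
proof -
  have "0 < level q j l" using assms(1,3) by (simp add: subcritical_def)
  also have "\<dots> \<le> u l"
    using assms by (intro level_le_chain) (auto simp: subcritical_def)
  finally show ?thesis .
qed

text \<open>Starting one step earlier replaces the value 1 at \<open>k + 1\<close> by
  \<open>1 - q k\<close>, and the monotone recursion preserves this order.\<close>

lemma level_mono_start:
  assumes "\<And>i. 0 \<le> q i" and "\<And>j i. i \<le> n \<Longrightarrow> 0 < level q j i" and "i < n"
  shows "level q k (Suc i) \<le> level q (Suc k) i"
  using assms(3)
proof (induction i)
  case (Suc i)
  have "q (Suc k + i) / level q (Suc k) i \<le> q (Suc k + i) / level q k (Suc i)"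
    using Suc assms(1) assms(2)[of "Suc i" k] assms(2)[of i "Suc k"]
    by (intro divide_left_mono mult_pos_pos) (auto simp del: level.simps)
  then show ?case
    by (subst (1 2) level.simps) (simp del: level.simps)
qed (use assms(1) in simp)

subsection \<open>Chains around the cycle\<close>

text \<open>\<open>Y\<close> and \<open>Z\<close> stand for terms of two solutions of a recurrence,
  \<open>Y'\<close> and \<open>Z'\<close> for the next terms. Once these are eliminated by their
  lower bounds, the two sides differ by \<open>t * (1 - t) * (1 - c) * (c * Y - Z)\<close>, which
  vanishes at both ends of the interpolation and is nonnegative between them.\<close>

lemma twisted_ineq:
  fixes c t Y Z Y' Z' :: real
  assumes t: "0 \<le> t" "t \<le> 1" and c: "0 < c" "c < 1"
    and "Z \<le> c * Y" and "(1 - c) * Y < Y'" and "0 < Z'" and "0 < Y" "0 < Z"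
  shows "((1-t)*c+t) * (((1-t)*Z+t*Y) - ((1-t)*Z'+t*Y')) < c * ((1-t)*Z+t*Y)"
proof -
  have pos: "0 < (1-t)*c+t" using t c by (cases "t=1") (auto intro!: add_pos_nonneg)
  have "t * ((1-c)*Y) < (1-t)*Z' + t*Y'"
  proof (cases "t = 0")
    case False
    then have "t * ((1-c)*Y) < t * Y'" using t assms by auto
    then show ?thesis using t assms by (smt (verit) mult_nonneg_nonneg)
  qed (use assms in simp)
  then have "((1-t)*Z+t*Y) - ((1-t)*Z'+t*Y') < (1-t)*Z + t*c*Y"
    by (simp add: algebra_simps)
  then have "((1-t)*c+t) * (((1-t)*Z+t*Y) - ((1-t)*Z'+t*Y')) < ((1-t)*c+t) * ((1-t)*Z + t*c*Y)"
    using pos by (rule mult_strict_left_mono)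
  also have "\<dots> = c * ((1-t)*Z+t*Y) - t*(1-t)*(1-c)*(c*Y-Z)"
    by (simp add: algebra_simps)
  also have "\<dots> \<le> c * ((1-t)*Z+t*Y)"
    using t c assms by simp
  finally show ?thesis .
qed

text \<open>
  The minimal chain with a given start is a ratio of consecutive terms of a linear recurrence, so that
  starts can be interpolated linearly between the extreme ones \<open>1 - q k\<close> (products \<open>Z\<close>) and 1
  (products \<open>Y\<close>), for which positivity of the levels refutes the twisted inequality.
\<close>

lemma no_twisted_chain:
  fixes u :: "nat \<Rightarrow> real"
  assumes sub: "subcritical (Suc m) q" and m: "0 < m" and q: "\<And>i. 0 < q i"
    and per: "\<And>i. q (i + Suc m) = q i"
    and u: "\<And>i. i \<le> m \<Longrightarrow> 0 \<le> u i" "\<And>i. i \<le> m \<Longrightarrow> u i \<le> 1"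
    and chain: "\<And>i. i < m \<Longrightarrow> u i * (1 - u (Suc i)) \<le> q (Suc k + i)"
    and twist: "1 - q k \<le> u 0 * (1 - u m)"
  shows False
proof -
  define c where "c = 1 - q k"
  \<comment> \<open>\<open>Y\<close> starts afresh at \<open>k + 1\<close>, while \<open>Z\<close>
    belongs to the cut at \<open>k\<close> with its level 0 dropped. So
    \<open>Y 0 = Z 0 = 1\<close>, but the first ratios are 1 and \<open>c\<close>.\<close>
  define Y where "Y i = (\<Prod>j<i. level q (Suc k) j)" for i
  define Z where "Z i = (\<Prod>j<i. level q k (Suc j))" for i
  have lev: "0 < level q j i" if "i \<le> Suc m" for i j
    using sub that by (auto simp: subcritical_def)
  have q0: "0 \<le> q i" for i using q[of i] by simp
  have c: "0 < c" "c < 1"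
    using lev[of 1 k] q[of k] by (auto simp: c_def)
  have Ypos: "0 < Y i" if "i \<le> Suc m" for i
    unfolding Y_def using that by (intro prod_pos lev) (auto intro: lev)
  have Zpos: "0 < Z i" if "i \<le> Suc m" for i
    unfolding Z_def using that by (intro prod_pos) (auto intro: lev simp del: level.simps)
  have Y2: "Y (Suc (Suc i)) = Y (Suc i) - q (Suc k + i) * Y i" if "i < Suc m" for i
    using lev[of i "Suc k"] that by (simp add: Y_def field_simps)
  have Z2: "Z (Suc (Suc i)) = Z (Suc i) - q (Suc k + i) * Z i" if "i < Suc m" for i
    using lev[of "Suc i" k] that unfolding Z_def prod.lessThan_Suc
    by (subst level.simps(2)[of q k "Suc i"]) (simp add: field_simps del: level.simps)
  have ZY: "Z (Suc i) \<le> c * Y (Suc i)" if "i \<le> m" for i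
    using that
  proof (induction i)
    case (Suc i)
    have "Z (Suc i) * level q k (Suc (Suc i)) \<le> (c * Y (Suc i)) * level q (Suc k) (Suc i)"
    proof (rule mult_mono)
      show "level q k (Suc (Suc i)) \<le> level q (Suc k) (Suc i)"
        using Suc.prems lev by (intro level_mono_start[where n="Suc m"] q0) auto
      show "0 \<le> level q k (Suc (Suc i))"
        using lev[of "Suc (Suc i)" k] Suc.prems by (simp del: level.simps)
      show "0 \<le> c * Y (Suc i)" using c Ypos[of "Suc i"] Suc.prems by simp
    qed (use Suc in simp)
    then show ?case unfolding Z_def Y_def prod.lessThan_Suc[of _ "Suc i"] by (simp add: mult.assoc del: level.simps)
  qed (simp add: Z_def Y_def c_def)
  \<comment> \<open>Since \<open>1 - u m\<close> is at most 1, the twist places \<open>u 0\<close>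
    between the extreme starts \<open>c\<close> and 1; \<open>t\<close> is its position
    there.\<close>
  have u0: "c \<le> u 0"
    using twist u(1)[of 0] u(1)[of m] unfolding c_def
    by (smt (verit) mult_left_le le0 order_refl)
  define t where "t = (u 0 - c) / (1 - c)"
  have t: "0 \<le> t" "t \<le> 1"
    using u0 c u(2)[of 0] by (auto simp: t_def)
  have "t * (1 - c) = u 0 - c" using c by (simp add: t_def)
  then have t3: "(1 - t) * c + t = u 0" by (simp add: algebra_simps)
  define y where "y i = (1-t) * Z i + t * Y i" for i
  have y: "0 < y i" if "i \<le> Suc m" for i
    using t Ypos[OF that] Zpos[OF that] unfolding y_def
    by (cases "t = 0") (auto intro!: add_nonneg_pos)
  have below: "y (Suc i) \<le> u i * y i" if "i \<le> m" for i
    using that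
  proof (induction i)
    case 0
    show ?case using t3 by (simp add: y_def Y_def Z_def c_def)
  next
    case (Suc i)
    have "y (Suc (Suc i)) = y (Suc i) - q (Suc k + i) * y i"
      using Suc.prems by (simp add: y_def Y2 Z2 algebra_simps)
    also have "\<dots> \<le> y (Suc i) - (u i * (1 - u (Suc i))) * y i"
      using chain[of i] y[of i] Suc.prems by (simp add: mult_right_mono)
    also have "\<dots> = y (Suc i) - (1 - u (Suc i)) * (u i * y i)" by simp
    also have "\<dots> \<le> y (Suc i) - (1 - u (Suc i)) * y (Suc i)"
      using Suc u(2)[of "Suc i"] by (simp add: mult_left_mono)
    finally show ?case by (simp add: algebra_simps)
  qed
  have "c * y m \<le> u 0 * (1 - u m) * y m"
    using twist y[of m] by (simp add: c_def mult_right_mono)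
  also have "\<dots> = u 0 * (y m - u m * y m)" by (simp add: algebra_simps)
  also have "\<dots> \<le> u 0 * (y m - y (Suc m))"
    using below[of m] u(1)[of 0] by (simp add: mult_left_mono)
  also have "\<dots> < c * y m"
    unfolding y_def t3[symmetric]
  proof (rule twisted_ineq)
    \<comment> \<open>This is positivity of the level that completes the round from
      \<open>k + 1\<close>: its last weight \<open>q (Suc k + m)\<close> is \<open>q k\<close> by
      periodicity.\<close>
    have "q k < level q (Suc k) m"
      using lev[of "Suc m" "Suc k"] lev[of m "Suc k"] per[of k] by (simp add: field_simps)
    then show "(1 - c) * Y m < Y (Suc m)"
      using Ypos[of m] by (simp add: Y_def c_def)
    show "Z m \<le> c * Y m" using ZY[of "m - 1"] m by simp
  qed (use t c Ypos[of m] Zpos[of m] Zpos[of "Suc m"] in auto)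
  finally show False by simp
qed

text \<open>A vertex of the polygon of weight distributions satisfying two linear inequalities.\<close>

lemma three_slices:
  fixes x y z A B C D :: real
  assumes "0 \<le> x" "0 \<le> y" "0 \<le> z" "x + y + z = 1" and "0 \<le> A" "A \<le> B" "0 \<le> D" "D \<le> C"
  obtains x' y' z' where "0 \<le> x'" "0 \<le> y'" "0 \<le> z'" "x' + y' + z' = 1"
    "x' = 0 \<or> y' = 0 \<or> z' = 0"
    "y' * A + z' * B \<le> y * A + z * B" "x' * C + y' * D \<le> x * C + y * D"
proof (cases "B = 0 \<or> C = 0")
  case True
  then show ?thesis
  proof
    assume "B = 0"
    then show ?thesis using assms by (intro that[of 0 0 1]) auto
  next
    assume "C = 0"
    then show ?thesis using assms by (intro that[of 1 0 0]) auto
  qed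
next
  case False
  then have BC: "0 < B" "0 < C" using assms by auto
  \<comment> \<open>Exchanging an amount of the middle slice for a share \<alpha> of the first and
    \<open>1 - \<alpha>\<close> of the last keeps the second functional fixed, so the exchange is
    run in whichever direction does not increase the first.\<close>
  define \<alpha> where "\<alpha> = D / C"
  have \<alpha>: "0 \<le> \<alpha>" "\<alpha> \<le> 1" "\<alpha> * C = D" using assms BC by (auto simp: \<alpha>_def)
  show ?thesis
  proof (cases "(1 - \<alpha>) * B \<le> A")
    case True
    have "y * ((1-\<alpha>) * B) \<le> y * A" using True assms by (intro mult_left_mono)
    moreover have "(x + y * \<alpha>) * C = x * C + y * D" using \<alpha>(3) by (simp add: algebra_simps)
    moreover have "0 \<le> y * \<alpha>" "y * \<alpha> \<le> y" using \<alpha> assms by (simp_all add: mult_left_le)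
    ultimately show ?thesis
      using assms \<alpha> by (intro that[of "x + y * \<alpha>" 0 "z + y * (1-\<alpha>)"]) (auto simp: algebra_simps)
  next
    case False
    then have \<alpha>1: "\<alpha> < 1" using assms \<alpha> by (cases "\<alpha> = 1") auto
    \<comment> \<open>The reverse exchange; \<open>s\<close> is the largest amount that the outer
      slices can supply, so one of them becomes empty.\<close>
    define s where "s = (if \<alpha> = 0 \<or> z * \<alpha> \<le> x * (1-\<alpha>) then z / (1-\<alpha>) else x / \<alpha>)"
    have s: "0 \<le> s \<and> \<alpha> * s \<le> x \<and> (1-\<alpha>) * s \<le> z \<and> (x = \<alpha> * s \<or> z = (1-\<alpha>) * s)"
    proof (cases "\<alpha> = 0 \<or> z * \<alpha> \<le> x * (1-\<alpha>)")
      case True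
      have "\<alpha> * z \<le> x * (1-\<alpha>)" using True assms \<alpha> by (auto simp: mult.commute)
      then show ?thesis using True \<alpha>1 assms(3) by (simp add: s_def pos_divide_le_eq)
    next
      case False
      then have "0 < \<alpha>" "x * (1-\<alpha>) \<le> z * \<alpha>" using \<alpha> by auto
      then show ?thesis using False assms(1) by (simp add: s_def pos_divide_le_eq mult.commute)
    qed
    have "s * A \<le> s * ((1-\<alpha>) * B)" using False s by (intro mult_left_mono) auto
    moreover have "s * (\<alpha> * C) = s * D" using \<alpha> by simp
    ultimately show ?thesis
      using s assms by (intro that[of "x - \<alpha> * s" "y + s" "z - (1-\<alpha>) * s"]) (auto simp: algebra_simps)
  qed
qed

text \<open>
  Vertex \<open>i\<close> is divided into slices of widths \<open>v (n + i)\<close>, \<open>v i - v (n + i)\<close> and \<open>1 - v i\<close>. Removing one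
  of them at the successor of a vertex \<open>k\<close> with \<open>v k = 1\<close> either cuts the chain down to one round,
  makes it twisted, or yields \<open>v (k + 1) = 1\<close>.
\<close>

lemma no_double_chain:
  fixes v :: "nat \<Rightarrow> real"
  assumes sub: "subcritical n q" and n: "2 \<le> n" and q: "\<And>i. 0 < q i"
    and per: "\<And>i. q (i + n) = q i"
    and bd: "\<And>i. i \<le> n \<Longrightarrow> 0 \<le> v (n + i)" "\<And>i. i \<le> n \<Longrightarrow> v (n + i) \<le> v i" "\<And>i. i \<le> n \<Longrightarrow> v i \<le> 1"
    and joint: "\<And>i. i < n \<Longrightarrow>
      v i * (1 - v (Suc i)) + v (n + i) * (v (Suc i) - v (Suc (n + i))) \<le> q i"
    and start: "v 0 = 1" and stop: "v (n + n) = 0" and k: "k \<le> n" "v k = 1"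
  shows False
  using k bd joint start stop
proof (induction "n - k" arbitrary: k v)
  case (0 k v)
  have q0: "0 \<le> q i" for i using q[of i] by simp
  \<comment> \<open>Now \<open>v n = 1\<close>, so the second round alone descends from 1 to 0 in
    \<open>n\<close> steps.\<close>
  have "0 < v (n + n)"
  proof (rule subcritical_chain_pos[OF sub q0 order_refl, of "\<lambda>i. v (n + i)" 0])
    fix i assume "i < n"
    have "v (n + i) * (1 - v (n + Suc i)) = v (n + i) * (1 - v (Suc i)) + v (n + i) * (v (Suc i) - v (Suc (n + i)))"
      by (simp add: algebra_simps)
    also have "\<dots> \<le> q i"
      using \<open>i < n\<close> 0(4-6)[of i] 0(6)[of "Suc i"] 0(7)[of i]
      by (smt (verit) Suc_leI less_imp_le mult_right_mono)
    finally show "v (n + i) * (1 - v (n + Suc i)) \<le> q (0 + i)" by simp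
  next
    show "1 \<le> v (n + 0)" using 0 by simp
  qed
  then show False using 0 by simp
next
  case (Suc d k v)
  note bd = Suc.prems(3-5) and joint = Suc.prems(6)
  have q0: "0 \<le> q i" for i using q[of i] by simp
  have kn: "k < n" using Suc.hyps(2) by simp
  \<comment> \<open>If the second copy of \<open>k + 1\<close> is empty, the joint inequality at
    \<open>k\<close> factors into \<open>1 - q k \<le> u (Suc k) * (1 - u (n + k))\<close>, which
    closes up the other \<open>n - 1\<close> edges as a twisted chain.\<close>
  have twisted: False if "u (Suc (n + k)) = 0" "u k = 1"
    and ubd: "\<And>i. i \<le> n \<Longrightarrow> 0 \<le> u (n + i)" "\<And>i. i \<le> n \<Longrightarrow> u (n + i) \<le> u i" "\<And>i. i \<le> n \<Longrightarrow> u i \<le> 1"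
    and uj: "\<And>i. i < n \<Longrightarrow> u i * (1 - u (Suc i)) + u (n + i) * (u (Suc i) - u (Suc (n + i))) \<le> q i"
    for u :: "nat \<Rightarrow> real"
  proof -
    have ub: "0 \<le> u i" "u i \<le> 1" if "i \<le> n + n" for i
      using ubd(1-3)[of i] ubd(1-3)[of "i - n"] that by (cases "i \<le> n"; force)+
    have lo: "u i * (1 - u (Suc i)) \<le> q i" if "i < n" for i
    proof -
      have "0 \<le> u (n + i) * (u (Suc i) - u (Suc (n + i)))"
        using ubd(1)[of i] ubd(2)[of "Suc i"] that by simp
      then show ?thesis using uj[OF that] by linarith
    qed
    have hi: "u (n + i) * (1 - u (Suc (n + i))) \<le> q i" if "i < n" for i
    proof -
      have "u (n + i) * (1 - u (Suc (n + i))) = u (n + i) * (1 - u (Suc i)) + u (n + i) * (u (Suc i) - u (Suc (n + i)))"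
        by (simp add: algebra_simps)
      also have "\<dots> \<le> q i"
        using that ubd(2)[of i] ubd(3)[of "Suc i"] uj[of i]
        by (smt (verit) Suc_leI less_imp_le mult_right_mono)
      finally show ?thesis .
    qed
    obtain m where m: "n = Suc m" using n by (cases n) auto
    show False
    proof (rule no_twisted_chain[of m q "\<lambda>i. u (Suc k + i)" k])
      fix i assume "i < m"
      show "u (Suc k + i) * (1 - u (Suc k + Suc i)) \<le> q (Suc k + i)"
      proof (cases "Suc k + i < n")
        case True then show ?thesis using lo[OF True] by simp
      next
        case False
        then obtain r where r: "Suc k + i = n + r" using le_Suc_ex not_less by blast
        then have "r < n" using \<open>i < m\<close> kn m by simp
        then show ?thesis using hi[of r] per[of r] r by (simp add: add.commute)
      qed
    next
      have *: "Suc k + m = n + k" using m by simp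
      show "1 - q k \<le> u (Suc k + 0) * (1 - u (Suc k + m))"
        unfolding * using uj[OF kn] that(1,2) by (simp add: algebra_simps)
    qed (use sub m n q per kn ub in auto)
  qed
  show False
  proof (cases "Suc k = n")
    case True
    then show False using twisted[of v] Suc.prems by (metis add_Suc_right)
  next
    case False
    define i where "i = Suc k"
    then have i: "0 < i" "i < n" "i - 1 = k" "Suc k = i" using False kn by auto
    \<comment> \<open>Only the edges \<open>k\<close> and \<open>i\<close> involve vertex
      \<open>i\<close>. Written in slice widths, the left-hand sides of their joint inequalities are
      the linear functionals in \<open>U\<close> and \<open>V\<close>.\<close>
    obtain x y z where xyz: "0 \<le> x" "0 \<le> y" "0 \<le> z" "x + y + z = 1"
      "x = 0 \<or> y = 0 \<or> z = 0"
      and U: "y * v (n + k) + z * v k \<le> (v i - v (n + i)) * v (n + k) + (1 - v i) * v k"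
      and V: "x * (1 - v (Suc (n + i))) + y * (1 - v (Suc i))
         \<le> v (n + i) * (1 - v (Suc (n + i))) + (v i - v (n + i)) * (1 - v (Suc i))"
      using three_slices[of "v (n + i)" "v i - v (n + i)" "1 - v i" "v (n + k)" "v k" "1 - v (Suc i)" "1 - v (Suc (n + i))"]
        bd(1-3)[of i] bd(1-3)[of k] bd(2,3)[of "Suc i"] i kn by auto
    define w where "w = v(i := x + y, n + i := x)"
    have w: "w i = x + y" "w (n + i) = x" "\<And>j. j \<noteq> i \<Longrightarrow> j \<noteq> n + i \<Longrightarrow> w j = v j"
      using i by (auto simp: w_def)
    have wk: "w k = 1" "w 0 = 1" "w (n + n) = 0"
      using w(3)[of k] w(3)[of 0] w(3)[of "n + n"] i Suc.prems by auto
    have wbd: "0 \<le> w (n + j)" "w (n + j) \<le> w j" "w j \<le> 1" if "j \<le> n" for j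
    proof -
      have "0 \<le> w (n + j) \<and> w (n + j) \<le> w j \<and> w j \<le> 1"
      proof (cases "j = i")
        case False
        then have *: "w (n + j) = v (n + j)" using w(3)[of "n + j"] that i by auto
        show ?thesis
        proof (cases "j = n + i")
          case True then show ?thesis using that i by simp
        next
          case False then show ?thesis using \<open>j \<noteq> i\<close> * w(3)[of j] bd[of j] that by auto
        qed
      qed (use w xyz in auto)
      then show "0 \<le> w (n + j)" "w (n + j) \<le> w j" "w j \<le> 1" by auto
    qed
    have wj: "w j * (1 - w (Suc j)) + w (n + j) * (w (Suc j) - w (Suc (n + j))) \<le> q j" if "j < n" for j
    proof -
      consider "j = i" | "j = k" | "j \<noteq> i" "j \<noteq> k" by blast
      then show ?thesis
      proof cases
        case 1
        have e: "w (Suc j) = v (Suc j)" "w (Suc (n + j)) = v (Suc (n + j))"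
          using w(3)[of "Suc j"] w(3)[of "Suc (n + j)"] 1 i by auto
        have "(x + y) * (1 - v (Suc i)) + x * (v (Suc i) - v (Suc (n + i)))
          = x * (1 - v (Suc (n + i))) + y * (1 - v (Suc i))" by (simp add: algebra_simps)
        also note V
        also have "v (n + i) * (1 - v (Suc (n + i))) + (v i - v (n + i)) * (1 - v (Suc i))
          = v i * (1 - v (Suc i)) + v (n + i) * (v (Suc i) - v (Suc (n + i)))" by (simp add: algebra_simps)
        also have "\<dots> \<le> q i" using joint[OF i(2)] .
        finally show ?thesis unfolding 1 e[unfolded 1] w(1,2) .
      next
        case 2
        have e: "w k = v k" "w (n + k) = v (n + k)" "Suc (n + k) = n + i"
          using w(3)[of k] w(3)[of "n + k"] i by auto
        have z: "z = 1 - (x + y)" using xyz by simp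
        have "v k * (1 - (x + y)) + v (n + k) * (x + y - x)
          = y * v (n + k) + z * v k" unfolding z by (simp add: algebra_simps)
        also note U
        also have "(v i - v (n + i)) * v (n + k) + (1 - v i) * v k
          = v k * (1 - v i) + v (n + k) * (v i - v (n + i))" by (simp add: algebra_simps)
        also have "\<dots> \<le> q k" using joint[OF kn] i e by simp
        finally show ?thesis unfolding 2 i(4) e w(1,2) .
      next
        case 3
        then have "w j = v j" "w (Suc j) = v (Suc j)" "w (n + j) = v (n + j)" "w (Suc (n + j)) = v (Suc (n + j))"
          using w(3)[of j] w(3)[of "Suc j"] w(3)[of "n + j"] w(3)[of "Suc (n + j)"] i that by auto
        then show ?thesis using joint[OF that] by simp
      qed
    qed
    from xyz(5) consider "x = 0" | "y = 0" | "z = 0" by blast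
    then show False
    proof cases
      case 1
      have "w (Suc (n + k)) = 0" using w(2) 1 i by (metis add_Suc_right)
      then show False using twisted[of w] wk wbd wj by blast
    next
      case 2
      \<comment> \<open>Without a middle slice the two copies of \<open>i\<close> agree. Following
        the first round up to \<open>i\<close> and the second one from there on is a single round
        from 1 to 0.\<close>
      define u where "u j = (if j \<le> i then w j else w (n + j))" for j
      have "0 < u n"
      proof (rule subcritical_chain_pos[OF sub q0 order_refl, of u 0])
        fix j assume "j < n"
        show "u j * (1 - u (Suc j)) \<le> q (0 + j)"
        proof (cases "Suc j \<le> i")
          case True
          have "0 \<le> w (n + j) * (w (Suc j) - w (Suc (n + j)))"
            using wbd(1)[of j] wbd(2)[of "Suc j"] \<open>j < n\<close> by simp
          then show ?thesis using True wj[OF \<open>j < n\<close>] by (simp add: u_def)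
        next
          case False
          have "u j = w (n + j)"
            using False w(1,2) 2 by (cases "j = i") (auto simp: u_def)
          moreover have "w (n + j) * (1 - w (Suc (n + j))) = w (n + j) * (1 - w (Suc j)) + w (n + j) * (w (Suc j) - w (Suc (n + j)))"
            by (simp add: algebra_simps)
          moreover have "w (n + j) * (1 - w (Suc j)) \<le> w j * (1 - w (Suc j))"
            using wbd(2)[of j] wbd(3)[of "Suc j"] \<open>j < n\<close> by (intro mult_right_mono) auto
          moreover have "u (Suc j) = w (Suc (n + j))" using False by (simp add: u_def)
          ultimately show ?thesis using wj[OF \<open>j < n\<close>] by simp
        qed
      next
        show "1 \<le> u 0" using wk by (simp add: u_def)
      qed
      then show False using i wk by (simp add: u_def)
    next
      case 3
      have "w (Suc k) = 1" using 3 xyz w(1) i by simp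
      then show False
        using Suc.hyps(1)[of "Suc k" w, OF _ _ _ wbd wj wk(2,3)] Suc.hyps(2) kn by linarith
    qed
  qed
qed

subsection \<open>Covering families in product spaces\<close>

text \<open>Separation in the plane: if no such mixture existed, a functional
  \<open>a + \<kappa> * b\<close> of the centered values would be nonnegative almost everywhere.
  Having expectation 0, it would vanish almost everywhere, so the values would lie on one line, and
  two of them on opposite sides of the mean would mix to the mean itself.\<close>

lemma (in prob_space) two_point_mixture:
  fixes u v :: "'a \<Rightarrow> real"
  assumes int: "integrable M u" "integrable M v" and P: "AE x in M. P x"
  obtains x y w where "P x" "P y" "0 \<le> w" "w \<le> 1"
    "w * u x + (1 - w) * u y \<le> expectation u" "w * v x + (1 - w) * v y \<le> expectation v"
proof -
  have "\<exists>x y w. P x \<and> P y \<and> 0 \<le> w \<and> w \<le> 1 \<and>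
    w * u x + (1 - w) * u y \<le> expectation u \<and> w * v x + (1 - w) * v y \<le> expectation v"
  proof (rule ccontr)
    assume none: "\<not> ?thesis"
    define a b where "a x = u x - expectation u" and "b x = v x - expectation v" for x
    have mix: "0 < w * a x + (1 - w) * a y \<or> 0 < w * b x + (1 - w) * b y"
      if "P x" "P y" "0 \<le> w" "w \<le> 1" for x y w
    proof -
      have "w * a x + (1 - w) * a y = w * u x + (1 - w) * u y - expectation u"
        "w * b x + (1 - w) * b y = w * v x + (1 - w) * v y - expectation v"
        by (simp_all add: a_def b_def algebra_simps)
      then show ?thesis using none that by (smt (verit))
    qed
    have one: "0 < a x \<or> 0 < b x" if "P x" for x
      using mix[of x x 1] that by simp
    have two: "(- a x) * (- b y) < a y * b x" if "P x" "P y" "a x \<le> 0" "b y \<le> 0" for x y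
    proof (rule ccontr)
      assume neg: "\<not> ?thesis"
      have pos: "0 < b x" "0 < a y" using one that by fastforce+
      define w where "w = a y / (a y - a x)"
      have w: "0 \<le> w" "w \<le> 1" "w * (a y - a x) = a y" "0 < a y - a x"
        using pos that by (auto simp: w_def)
      have "(a y - a x) * (w * a x + (1 - w) * a y) = (w * (a y - a x)) * a x + ((a y - a x) - w * (a y - a x)) * a y"
        by (simp add: algebra_simps)
      also have "\<dots> = 0" unfolding w(3) by (simp add: algebra_simps)
      finally have 1: "w * a x + (1 - w) * a y = 0" using w by simp
      have "(a y - a x) * (w * b x + (1 - w) * b y) = (w * (a y - a x)) * b x + ((a y - a x) - w * (a y - a x)) * b y"
        by (simp add: algebra_simps)
      also have "\<dots> \<le> 0" unfolding w(3) using neg by (simp add: algebra_simps)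
      finally have "w * b x + (1 - w) * b y \<le> 0" using w(4) by (simp add: mult_le_0_iff)
      then show False using mix[OF that(1,2) w(1,2)] 1 by simp
    qed
    have inta: "integrable M a" "integrable M b" using int by (auto simp: a_def[abs_def] b_def[abs_def])
    have exp0: "expectation a = 0" "expectation b = 0"
      using int prob_space by (auto simp: a_def[abs_def] b_def[abs_def])
    have not_pos: "\<not> (AE x in M. 0 < f x)" if "integrable M f" "expectation f = 0" for f :: "'a \<Rightarrow> real"
      using expectation_greater[OF that(1), of 0] that(2) by auto
    have ex: "\<exists>x. P x \<and> Q x \<and> f x \<le> 0" if "integrable M f" "expectation f = 0" "AE x in M. Q x" for f :: "'a \<Rightarrow> real" and Q
    proof (rule ccontr)
      assume "\<not> ?thesis"
      then have "AE x in M. 0 < f x" using P that(3) by (auto elim!: eventually_elim2 simp: not_le)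
      then show False using not_pos that by blast
    qed
    \<comment> \<open>Points with \<open>a x \<le> 0\<close> bound the separating coefficient
      \<kappa> from below by \<open>- a x / b x\<close>, points with \<open>b y < 0\<close> bound it
      from above by \<open>a y / (- b y)\<close>; fact \<open>two\<close> says that these bounds are
      compatible.\<close>
    define K where "K = {- a x / b x | x. P x \<and> a x \<le> 0}"
    have Kne: "K \<noteq> {}" using ex[OF inta(1) exp0(1), of "\<lambda>_. True"] by (auto simp: K_def)
    have Knn: "0 \<le> r" if r: "r \<in> K" for r
    proof -
      obtain x where "r = - a x / b x" "P x" "a x \<le> 0" using r unfolding K_def by blast
      moreover have "0 < b x" using one[of x] \<open>P x\<close> \<open>a x \<le> 0\<close> by auto
      ultimately show ?thesis by (simp add: divide_nonpos_pos)
    qed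
    have cross: "s / p \<le> t / q" if "0 < p" "0 < q" "s * q < t * p" for s t p q :: real
      using that by (simp add: field_simps)
    \<comment> \<open>This point makes \<open>K\<close> bounded. Without it \<open>b\<close> would
      vanish, and hence \<open>a\<close> be positive, almost everywhere.\<close>
    have "\<exists>y. P y \<and> b y < 0"
    proof (rule ccontr)
      assume "\<not> ?thesis"
      then have "AE x in M. 0 \<le> b x" using P by (auto elim!: eventually_mono simp: not_less)
      then have "AE x in M. b x = 0"
        using integral_nonneg_eq_0_iff_AE[OF inta(2)] exp0(2) by blast
      then have "AE x in M. 0 < a x"
        using P by (rule eventually_elim2) (use one in fastforce)
      then show False using not_pos inta exp0 by blast
    qed
    then obtain y0 where y0: "P y0" "b y0 < 0" by blast
    have "bdd_above K"
    proof (rule bdd_aboveI)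
      fix r assume "r \<in> K"
      then obtain x where x: "r = - a x / b x" "P x" "a x \<le> 0" unfolding K_def by blast
      then have "0 < b x" using one[of x] by auto
      then show "r \<le> a y0 / (- b y0)" 
        
        unfolding x(1) using two[of x y0] x y0 by (intro cross) auto
    qed
    define \<kappa> where "\<kappa> = Sup K"
    have \<kappa>: "0 \<le> \<kappa>" using Kne Knn cSup_upper[OF _ \<open>bdd_above K\<close>] unfolding \<kappa>_def by force
    have lo: "- a x \<le> \<kappa> * b x" if "P x" "a x \<le> 0" for x
    proof -
      have "- a x / b x \<le> \<kappa>"
        unfolding \<kappa>_def using that by (intro cSup_upper \<open>bdd_above K\<close>) (auto simp: K_def)
      moreover have "0 < b x" using one[of x] that by simp
      ultimately show ?thesis by (metis pos_divide_le_eq)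
    qed
    have hi: "\<kappa> * (- b y) \<le> a y" if "P y" "b y \<le> 0" for y
    proof (cases "b y = 0")
      case True
      then show ?thesis using one[of y] that by simp
    next
      case False
      have "\<kappa> \<le> a y / (- b y)"
        unfolding \<kappa>_def
      proof (rule cSup_least[OF Kne])
        fix r assume "r \<in> K"
        then obtain x where x: "r = - a x / b x" "P x" "a x \<le> 0" unfolding K_def by blast
        then have "0 < b x" using one[of x] by auto
        then show "r \<le> a y / (- b y)" 
          
        unfolding x(1) using two[of x y] x that False by (intro cross) auto
      qed
      then show ?thesis using False that by (simp add: field_simps)
    qed
    have nn: "0 \<le> a x + \<kappa> * b x" if "P x" for x
      using lo[of x] hi[of x] that \<kappa> by (cases "a x \<le> 0"; cases "b x \<le> 0") auto
    have "AE x in M. a x + \<kappa> * b x = 0"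
    proof (subst integral_nonneg_eq_0_iff_AE[symmetric])
      show "AE x in M. 0 \<le> a x + \<kappa> * b x" using P by eventually_elim (rule nn)
    qed (use inta exp0 in auto)
    then obtain x y where "P x" "a x + \<kappa> * b x = 0" "a x \<le> 0" "P y" "a y + \<kappa> * b y = 0" "b y \<le> 0"
      using ex[OF inta(1) exp0(1)] ex[OF inta(2) exp0(2)] by meson
    moreover from this have "a x = - \<kappa> * b x" "a y = - \<kappa> * b y" by linarith+
    then have "(- a x) * (- b y) = a y * b x" by simp
    ultimately show False using two[of x y] by simp
  qed
  then show ?thesis using that by blast
qed

text \<open>Inclusion-exclusion, where the overlap is largest when the sides are nested. From here
  on sets can be replaced by their measures.\<close>

lemma (in prob_space) measure_two_rectangles:
  assumes [measurable]: "E \<in> sets (M \<Otimes>\<^sub>M M)" "G \<in> sets M" "H \<in> sets M" "G' \<in> sets M" "H' \<in> sets M"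
    and GE: "AE z in M \<Otimes>\<^sub>M M. fst z \<in> G \<longrightarrow> snd z \<notin> G' \<longrightarrow> z \<in> E"
    and HE: "AE z in M \<Otimes>\<^sub>M M. fst z \<in> H \<longrightarrow> snd z \<notin> H' \<longrightarrow> z \<in> E"
  shows "prob G * (1 - prob G') + prob H * (1 - prob H')
    - min (prob G) (prob H) * min (1 - prob G') (1 - prob H') \<le> measure (M \<Otimes>\<^sub>M M) E"
proof -
  interpret P: pair_prob_space M M ..
  have times: "P.prob (A \<times> B) = prob A * prob B" if "A \<in> sets M" "B \<in> sets M" for A B
    using emeasure_pair_measure_Times[OF that] 
    by (simp add: measure_def enn2real_mult)
  let ?G = "G \<times> (space M - G')" and ?H = "H \<times> (space M - H')"
  have "P.prob (?G \<union> ?H) \<le> P.prob E"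
  proof (rule P.finite_measure_mono_AE)
    show "AE z in M \<Otimes>\<^sub>M M. z \<in> ?G \<union> ?H \<longrightarrow> z \<in> E"
      using GE HE by eventually_elim auto
  qed simp
  moreover have "P.prob (?G \<union> ?H) = P.prob ?G + P.prob ?H - P.prob (?G \<inter> ?H)"
    by (rule measure_Un3) (auto simp: P.fmeasurable_eq_sets)
  moreover have "P.prob (?G \<inter> ?H) = prob (G \<inter> H) * prob ((space M - G') \<inter> (space M - H'))"
    by (subst times[symmetric]) (auto intro!: arg_cong[where f="P.prob"])
  moreover have "\<dots> \<le> min (prob G) (prob H) * min (1 - prob G') (1 - prob H')"
  proof (intro mult_mono)
    show "prob (G \<inter> H) \<le> min (prob G) (prob H)" by (auto intro: finite_measure_mono)
    show "prob ((space M - G') \<inter> (space M - H')) \<le> min (1 - prob G') (1 - prob H')"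
      by (simp add: prob_compl[symmetric]) (auto intro!: finite_measure_mono)
  qed auto
  ultimately show ?thesis by (simp add: times prob_compl)
qed

text \<open>
  Positivity of the kernel is an essential version of reachability; the projections defining literal
  reachability need not be measurable.
\<close>

primrec (in sigma_finite_measure) path_kernel :: "(nat \<Rightarrow> ('a \<times> 'a) set) \<Rightarrow> nat \<Rightarrow> 'a \<Rightarrow> 'a \<Rightarrow> ennreal" where
  "path_kernel U 0 x z = indicator (U 0) (x, z)"
| "path_kernel U (Suc k) x z = (\<integral>\<^sup>+y. path_kernel U k x y * indicator (U (Suc k)) (y, z) \<partial>M)"

lemma (in sigma_finite_measure) measurable_path_kernel:
  assumes U[measurable]: "\<And>i. U i \<in> sets (M \<Otimes>\<^sub>M M)"
  shows "(\<lambda>(x, z). path_kernel U k x z) \<in> borel_measurable (M \<Otimes>\<^sub>M M)"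
proof (induction k)
  case (Suc k)
  note Suc[measurable]
  show ?case by (simp add: split_beta') measurable
qed (simp add: split_beta')

text \<open>The weight \<open>g\<close> is arbitrary so that the induction can absorb the last
  coordinate into it; in the application it carries the event that closes the cycle.\<close>

lemma (in sigma_finite_measure) nn_integral_path_kernel:
  assumes U[measurable]: "\<And>i. U i \<in> sets (M \<Otimes>\<^sub>M M)"
    and g: "g \<in> borel_measurable (M \<Otimes>\<^sub>M M)"
  shows "(\<integral>\<^sup>+\<omega>. (\<Prod>i\<le>k. indicator (U i) (\<omega> (Suc i), \<omega> (Suc (Suc i)))) * g (\<omega> 1, \<omega> (Suc (Suc k))) \<partial>(\<Pi>\<^sub>M i\<in>{1..Suc (Suc k)}. M))
    = (\<integral>\<^sup>+x. \<integral>\<^sup>+z. path_kernel U k x z * g (x, z) \<partial>M \<partial>M)"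
  using g
proof (induction k arbitrary: g)
  case (0 g)
  note [measurable] = 0
  interpret I: product_sigma_finite "\<lambda>_. M" by standard
  have "{1..Suc (Suc 0)} = {1, 2::nat}" by auto
  then show ?case
    using I.product_nn_integral_pair[of "\<lambda>x y. indicator (U 0) (x, y) * g (x, y)" 1 "2::nat"]
    by (simp add: nn_integral_fst[symmetric] numeral_2_eq_2)
next
  case (Suc k g)
  note [measurable] = Suc(2) measurable_path_kernel[OF U, unfolded split_beta']
  interpret I: product_sigma_finite "\<lambda>_. M" by standard
  interpret PP: pair_sigma_finite M M ..
  define n where "n = Suc (Suc (Suc k))"
  let ?g = "\<lambda>(x, y). \<integral>\<^sup>+z. indicator (U (Suc k)) (y, z) * g (x, z) \<partial>M"
  have g': "?g \<in> borel_measurable (M \<Otimes>\<^sub>M M)" by (simp add: split_beta') measurable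
  have ins: "{1..n} = insert n {1..Suc (Suc k)}" by (auto simp: n_def)
  have "(\<integral>\<^sup>+\<omega>. (\<Prod>i\<le>Suc k. indicator (U i) (\<omega> (Suc i), \<omega> (Suc (Suc i)))) * g (\<omega> 1, \<omega> n) \<partial>(\<Pi>\<^sub>M i\<in>{1..n}. M))
    = (\<integral>\<^sup>+\<omega>. \<integral>\<^sup>+z. (\<Prod>i\<le>Suc k. indicator (U i) ((fun_upd \<omega> n z) (Suc i), (fun_upd \<omega> n z) (Suc (Suc i))))
        * g ((fun_upd \<omega> n z) 1, (fun_upd \<omega> n z) n) \<partial>M \<partial>(\<Pi>\<^sub>M i\<in>{1..Suc (Suc k)}. M))"
    unfolding ins 
  proof (rule I.product_nn_integral_insert)
    show "(\<lambda>\<omega>. (\<Prod>i\<le>Suc k. indicator (U i) (\<omega> (Suc i), \<omega> (Suc (Suc i)))) * g (\<omega> 1, \<omega> n))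
      \<in> borel_measurable (\<Pi>\<^sub>M i\<in>insert n {1..Suc (Suc k)}. M)"
      unfolding ins[symmetric]
      by (intro borel_measurable_times_ennreal borel_measurable_prod_ennreal
          measurable_compose[OF _ borel_measurable_indicator[OF U]] measurable_compose[OF _ Suc(2)]
          measurable_Pair measurable_component_singleton) (auto simp: n_def)
  qed (auto simp: n_def)
  also have "\<dots> = (\<integral>\<^sup>+\<omega>. \<integral>\<^sup>+z. (\<Prod>i\<le>k. indicator (U i) (\<omega> (Suc i), \<omega> (Suc (Suc i)))) *
       (indicator (U (Suc k)) (\<omega> (Suc (Suc k)), z) * g (\<omega> 1, z)) \<partial>M \<partial>(\<Pi>\<^sub>M i\<in>{1..Suc (Suc k)}. M))"
    by (intro nn_integral_cong) (simp add: mult.assoc n_def)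
  also have "\<dots> = (\<integral>\<^sup>+\<omega>. (\<Prod>i\<le>k. indicator (U i) (\<omega> (Suc i), \<omega> (Suc (Suc i)))) * ?g (\<omega> 1, \<omega> (Suc (Suc k)))
       \<partial>(\<Pi>\<^sub>M i\<in>{1..Suc (Suc k)}. M))"
  proof (intro nn_integral_cong)
    fix \<omega> assume "\<omega> \<in> space (\<Pi>\<^sub>M i\<in>{1..Suc (Suc k)}. M)"
    then have [measurable]: "\<omega> (Suc 0) \<in> space M" "\<omega> (Suc (Suc k)) \<in> space M" by (auto simp: space_PiM)
    show "(\<integral>\<^sup>+z. (\<Prod>i\<le>k. indicator (U i) (\<omega> (Suc i), \<omega> (Suc (Suc i)))) *
       (indicator (U (Suc k)) (\<omega> (Suc (Suc k)), z) * g (\<omega> 1, z)) \<partial>M)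
      = (\<Prod>i\<le>k. indicator (U i) (\<omega> (Suc i), \<omega> (Suc (Suc i)))) * ?g (\<omega> 1, \<omega> (Suc (Suc k)))"
      by (simp, intro nn_integral_cmult) measurable
  qed
  also have "\<dots> = (\<integral>\<^sup>+x. \<integral>\<^sup>+y. path_kernel U k x y * ?g (x, y) \<partial>M \<partial>M)"
    by (rule Suc.IH[OF g'])
  also have "\<dots> = (\<integral>\<^sup>+x. \<integral>\<^sup>+z. path_kernel U (Suc k) x z * g (x, z) \<partial>M \<partial>M)"
  proof (rule nn_integral_cong)
    fix x assume x: "x \<in> space M"
    have [measurable]: "path_kernel U k x \<in> borel_measurable M" "(\<lambda>z. g (x, z)) \<in> borel_measurable M"
      using measurable_compose[OF measurable_Pair1'[OF x] measurable_path_kernel[OF U]]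
        measurable_compose[OF measurable_Pair1'[OF x] Suc(2)] by auto
    have "(\<integral>\<^sup>+y. path_kernel U k x y * ?g (x, y) \<partial>M)
      = (\<integral>\<^sup>+y. \<integral>\<^sup>+z. path_kernel U k x y * (indicator (U (Suc k)) (y, z) * g (x, z)) \<partial>M \<partial>M)"
      by (intro nn_integral_cong) (simp add: nn_integral_cmult)
    also have "\<dots> = (\<integral>\<^sup>+z. \<integral>\<^sup>+y. path_kernel U k x y * (indicator (U (Suc k)) (y, z) * g (x, z)) \<partial>M \<partial>M)"
      by (rule PP.Fubini') measurable
    also have "\<dots> = (\<integral>\<^sup>+z. path_kernel U (Suc k) x z * g (x, z) \<partial>M)"
      by (intro nn_integral_cong) (simp add: nn_integral_multc[symmetric] mult.assoc)
    finally show "(\<integral>\<^sup>+y. path_kernel U k x y * ?g (x, y) \<partial>M) = (\<integral>\<^sup>+z. path_kernel U (Suc k) x z * g (x, z) \<partial>M)" .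
  qed
  finally show ?case unfolding n_def .
qed

text \<open>Here \<open>g\<close> and \<open>h\<close> play the measures of the sets reachable from
  two values of the first variable with weights \<open>w\<close> and \<open>1 - w\<close>.\<close>

lemma no_pair_of_chains:
  fixes g h :: "nat \<Rightarrow> real"
  assumes sub: "subcritical (Suc (Suc k)) q" and q: "\<And>i. 0 < q i"
    and per: "\<And>i. q (i + Suc (Suc k)) = q i"
    and g: "\<And>i. 0 \<le> g i" "\<And>i. g i \<le> 1" and h: "\<And>i. 0 \<le> h i" "\<And>i. h i \<le> 1"
    and w: "0 \<le> w" "w \<le> 1" and gh: "g 0 \<le> h 0"
    and first: "w * (1 - g 0) + (1 - w) * (1 - h 0) \<le> q 0"
    and step: "\<And>j. j < k \<Longrightarrow> g j * (1 - g (Suc j)) + h j * (1 - h (Suc j))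
      - min (g j) (h j) * min (1 - g (Suc j)) (1 - h (Suc j)) \<le> q (Suc j)"
    and last: "w * g k + (1 - w) * h k \<le> q (Suc k)"
  shows False
proof -
  define n where "n = Suc (Suc k)"
  \<comment> \<open>The first round follows \<open>h\<close>. Its closing event excludes a return to
    the value of weight \<open>1 - w\<close>, which leaves \<open>w\<close> at position
    \<open>n\<close>; the second round follows \<open>g\<close> from there and ends with nothing.
    The minimum nests the second round in the first, and \<open>g 0 \<le> h 0\<close> makes it
    harmless at the start.\<close>
  define v where "v i = (if i = 0 then 1 else if i < n then h (i - 1) else if i = n then w
    else if i < n + n then min (g (i - n - 1)) (h (i - n - 1)) else 0)" for i
  have v: "v 0 = 1" "v n = w" "v (n + n) = 0"
    "\<And>j. j \<le> k \<Longrightarrow> v (Suc j) = h j" "\<And>j. j \<le> k \<Longrightarrow> v (Suc (n + j)) = min (g j) (h j)"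
    by (auto simp: v_def n_def)
  have "0 \<le> v (n + i) \<and> v (n + i) \<le> v i \<and> v i \<le> 1" if i: "i \<le> n" for i
  proof -
    consider "i = 0" | j where "i = Suc j" "j \<le> k" | "i = n"
      using i unfolding n_def by (metis le_SucE not0_implies_Suc Suc_le_mono)
    then show ?thesis
      by cases (use v g h w in \<open>auto simp: min_le_iff_disj\<close>)
  qed
  then have bd: "\<And>i. i \<le> n \<Longrightarrow> 0 \<le> v (n + i)" "\<And>i. i \<le> n \<Longrightarrow> v (n + i) \<le> v i" "\<And>i. i \<le> n \<Longrightarrow> v i \<le> 1"
    by auto
  show False
  proof (rule no_double_chain[of n q v 0])
    fix i assume "i < n"
    then consider "i = 0" | j where "i = Suc j" "j < k" | "i = Suc k"
      by (cases i) (auto simp: n_def less_Suc_eq)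
    then show "v i * (1 - v (Suc i)) + v (n + i) * (v (Suc i) - v (Suc (n + i))) \<le> q i"
    proof cases
      case 1
      then show ?thesis using v(1,2) v(4,5)[of 0] gh first by (simp add: algebra_simps)
    next
      case 2
      have "(g j - min (g j) (h j)) * (1 - g (Suc j)) \<ge> 0" using g(2)[of "Suc j"] by simp
      then have "h j * (1 - h (Suc j)) + min (g j) (h j) * (h (Suc j) - min (g (Suc j)) (h (Suc j)))
        \<le> g j * (1 - g (Suc j)) + h j * (1 - h (Suc j)) - min (g j) (h j) * min (1 - g (Suc j)) (1 - h (Suc j))"
        by (cases "g (Suc j) \<le> h (Suc j)") (simp_all add: min_absorb1 min_absorb2 algebra_simps)
      also have "\<dots> \<le> q (Suc j)" using step[OF 2(2)] .
      finally show ?thesis using v(4)[of j] v(4)[of "Suc j"] v(5)[of j] v(5)[of "Suc j"] 2 by simp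
    next
      case 3
      have "v i = h k" "v (n + i) = min (g k) (h k)" "v (Suc i) = w" "v (Suc (n + i)) = 0"
        using v(4,5)[of k] v(2,3) 3 by (auto simp: n_def)
      moreover have "min (g k) (h k) * w \<le> g k * w" using w by (intro mult_right_mono) auto
      ultimately show ?thesis using last 3 by (simp add: algebra_simps)
    qed
  qed (use sub q per bd v in \<open>auto simp: n_def\<close>)
qed

section \<open>Reachable sets and the measure of uncovered points\<close>

context prob_space
begin

definition reach :: "(nat \<Rightarrow> ('a \<times> 'a) set) \<Rightarrow> nat \<Rightarrow> 'a \<Rightarrow> 'a set" where
  "reach U j x = {z \<in> space M. path_kernel U j x z \<noteq> 0}"

lemma path_kernel_section:
  assumes "\<And>i. U i \<in> sets (M \<Otimes>\<^sub>M M)" "x \<in> space M"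
  shows "path_kernel U j x \<in> borel_measurable M"
  using measurable_compose[OF measurable_Pair1'[OF assms(2)] measurable_path_kernel[OF assms(1)]] by simp

lemma reach_sets:
  assumes "\<And>i. U i \<in> sets (M \<Otimes>\<^sub>M M)" "x \<in> space M"
  shows "reach U j x \<in> sets M"
proof -
  note [measurable] = path_kernel_section[OF assms]
  show ?thesis unfolding reach_def by measurable
qed

text \<open>If \<open>z\<close> is not reached, a nonnegative integral over \<open>y\<close> is
  zero, so almost no reached \<open>y\<close> is joined to \<open>z\<close> by an uncovered pair.
  Fubini turns these section-wise null sets into one null set.\<close>

lemma reach_step:
  assumes U[measurable]: "\<And>i. U i \<in> sets (M \<Otimes>\<^sub>M M)" and x: "x \<in> space M"
  shows "AE p in M \<Otimes>\<^sub>M M. fst p \<in> reach U j x \<longrightarrow> snd p \<notin> reach U (Suc j) x \<longrightarrow> p \<notin> U (Suc j)"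
proof -
  interpret P: pair_sigma_finite M M ..
  note [measurable] = path_kernel_section[OF U x] reach_sets[OF U x]
  have "AE z in M. AE y in M. y \<in> reach U j x \<longrightarrow> z \<notin> reach U (Suc j) x \<longrightarrow> (y, z) \<notin> U (Suc j)"
  proof (rule AE_I2)
    fix z assume z[measurable]: "z \<in> space M"
    show "AE y in M. y \<in> reach U j x \<longrightarrow> z \<notin> reach U (Suc j) x \<longrightarrow> (y, z) \<notin> U (Suc j)"
    proof (cases "z \<in> reach U (Suc j) x")
      case False
      then have "(\<integral>\<^sup>+y. path_kernel U j x y * indicator (U (Suc j)) (y, z) \<partial>M) = 0"
        using z by (simp add: reach_def)
      then have "AE y in M. path_kernel U j x y * indicator (U (Suc j)) (y, z) = 0"
        by (subst (asm) nn_integral_0_iff_AE) simp_all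
      then show ?thesis
        by eventually_elim (auto simp: reach_def indicator_def split: if_splits)
    qed simp
  qed
  then have "AE y in M. AE z in M. y \<in> reach U j x \<longrightarrow> z \<notin> reach U (Suc j) x \<longrightarrow> (y, z) \<notin> U (Suc j)"
    by (subst P.AE_commute) simp_all
  then show ?thesis
    by (subst (asm) P.AE_pair_iff) simp_all
qed

text \<open>The sections \<open>S\<close> are left abstract to serve both for rows of the first
  event and for columns of the last.\<close>

lemma expectation_section:
  assumes "(\<lambda>x. emeasure M (S x)) \<in> borel_measurable M"
    and "(\<integral>\<^sup>+x. emeasure M (S x) \<partial>M) = emeasure (M \<Otimes>\<^sub>M M) E"
  shows "integrable M (\<lambda>x. prob (S x))" "expectation (\<lambda>x. prob (S x)) = measure (M \<Otimes>\<^sub>M M) E"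
proof -
  have m: "(\<lambda>x. prob (S x)) \<in> borel_measurable M"
    unfolding measure_def using assms(1) by measurable
  then show "integrable M (\<lambda>x. prob (S x))"
    by (intro integrable_const_bound[of _ 1]) auto
  have "expectation (\<lambda>x. prob (S x)) = enn2real (\<integral>\<^sup>+x. ennreal (prob (S x)) \<partial>M)"
    using m by (intro integral_eq_nn_integral) auto
  also have "\<dots> = measure (M \<Otimes>\<^sub>M M) E"
    unfolding emeasure_eq_measure[symmetric] assms(2) by (simp add: measure_def)
  finally show "expectation (\<lambda>x. prob (S x)) = measure (M \<Otimes>\<^sub>M M) E" .
qed

lemma cyclic_uncovered_pos:
  assumes sub: "subcritical n q" and n: "2 \<le> n" and q: "\<And>i. 0 < q i"
    and per: "\<And>i. q (i + n) = q i"
    and E: "\<And>i. i < n \<Longrightarrow> E i \<in> sets (M \<Otimes>\<^sub>M M)"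
    and Eq: "\<And>i. i < n \<Longrightarrow> measure (M \<Otimes>\<^sub>M M) (E i) \<le> q i"
  shows "emeasure (\<Pi>\<^sub>M i\<in>{1..n}. M)
    {\<omega> \<in> space (\<Pi>\<^sub>M i\<in>{1..n}. M). \<forall>i<n. (\<omega> (Suc i), \<omega> (Suc i mod n + 1)) \<notin> E i} \<noteq> 0"
proof
  assume zero: "emeasure (\<Pi>\<^sub>M i\<in>{1..n}. M)
    {\<omega> \<in> space (\<Pi>\<^sub>M i\<in>{1..n}. M). \<forall>i<n. (\<omega> (Suc i), \<omega> (Suc i mod n + 1)) \<notin> E i} = 0"
  define N where "N = {\<omega> \<in> space (\<Pi>\<^sub>M i\<in>{1..n}. M). \<forall>i<n. (\<omega> (Suc i), \<omega> (Suc i mod n + 1)) \<notin> E i}"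
  obtain k where k: "n = Suc (Suc k)" using n by (metis add_2_eq_Suc le_Suc_ex)
  have N: "N \<in> sets (\<Pi>\<^sub>M i\<in>{1..n}. M)"
  proof -
    have "N
      = {\<omega> \<in> space (\<Pi>\<^sub>M i\<in>{1..n}. M). \<forall>i\<in>{..<n}. (\<omega> (Suc i), \<omega> (Suc i mod n + 1)) \<notin> E i}" by (auto simp: N_def)
    also have "\<dots> \<in> sets (\<Pi>\<^sub>M i\<in>{1..n}. M)"
    proof (rule sets.sets_Collect_finite_All)
      fix i assume i: "i \<in> {..<n}"
      then have [measurable]: "E i \<in> sets (M \<Otimes>\<^sub>M M)" using E by auto
      have "Suc i mod n + 1 \<in> {1..n}" using i by (auto simp: Suc_le_eq)
      then have [measurable]: "(\<lambda>\<omega>. (\<omega> (Suc i), \<omega> (Suc i mod n + 1))) \<in> (\<Pi>\<^sub>M i\<in>{1..n}. M) \<rightarrow>\<^sub>M M \<Otimes>\<^sub>M M"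
        using i by (intro measurable_Pair measurable_component_singleton) auto
      show "{\<omega> \<in> space (\<Pi>\<^sub>M i\<in>{1..n}. M). (\<omega> (Suc i), \<omega> (Suc i mod n + 1)) \<notin> E i} \<in> sets (\<Pi>\<^sub>M i\<in>{1..n}. M)"
        by measurable
    qed simp
    finally show ?thesis .
  qed
  interpret P: pair_prob_space M M ..
  define U where "U i = (if i < n then space (M \<Otimes>\<^sub>M M) - E i else {})" for i
  have U[measurable]: "U i \<in> sets (M \<Otimes>\<^sub>M M)" for i using E by (auto simp: U_def)
  have E0[measurable]: "E 0 \<in> sets (M \<Otimes>\<^sub>M M)" and Ek[measurable]: "E (Suc k) \<in> sets (M \<Otimes>\<^sub>M M)"
    using E k by auto
  \<comment> \<open>The last event reads the coordinates \<open>n\<close> and 1 in this order, hence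
    the swap.\<close>
  let ?g = "\<lambda>(x, z). indicator (U (Suc k)) (z, x) :: ennreal"
  have g: "?g \<in> borel_measurable (M \<Otimes>\<^sub>M M)" by (simp add: split_beta')
  have "(\<integral>\<^sup>+x. \<integral>\<^sup>+z. path_kernel U k x z * ?g (x, z) \<partial>M \<partial>M)
    = (\<integral>\<^sup>+\<omega>. (\<Prod>i\<le>k. indicator (U i) (\<omega> (Suc i), \<omega> (Suc (Suc i)))) * ?g (\<omega> 1, \<omega> (Suc (Suc k))) \<partial>(\<Pi>\<^sub>M i\<in>{1..Suc (Suc k)}. M))"
    by (rule nn_integral_path_kernel[OF U g, symmetric])
  also have "\<dots> = (\<integral>\<^sup>+\<omega>. indicator N \<omega> \<partial>(\<Pi>\<^sub>M i\<in>{1..n}. M))"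
    unfolding k[symmetric]
  proof (rule nn_integral_cong)
    fix \<omega> assume \<omega>: "\<omega> \<in> space (\<Pi>\<^sub>M i\<in>{1..n}. M)"
    have sp: "(\<omega> (Suc i), \<omega> (Suc i mod n + 1)) \<in> space (M \<Otimes>\<^sub>M M)" if "i < n" for i
      using \<omega> that by (auto simp: space_pair_measure space_PiM PiE_iff k)
    have UE: "(\<omega> (Suc i), \<omega> (Suc i mod n + 1)) \<in> U i \<longleftrightarrow> (\<omega> (Suc i), \<omega> (Suc i mod n + 1)) \<notin> E i" if "i < n" for i
      using sp[OF that] that by (auto simp: U_def)
    have "(\<forall>i<n. (\<omega> (Suc i), \<omega> (Suc i mod n + 1)) \<notin> E i) \<longleftrightarrow>
      (\<forall>i\<le>k. (\<omega> (Suc i), \<omega> (Suc (Suc i))) \<in> U i) \<and> (\<omega> n, \<omega> 1) \<in> U (Suc k)" (is "?L = ?R")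
    proof -
      have "?L \<longleftrightarrow> (\<forall>i<n. (\<omega> (Suc i), \<omega> (Suc i mod n + 1)) \<in> U i)" using UE by blast
      also have "\<dots> \<longleftrightarrow> ?R"
      proof -
        have "i < n \<longleftrightarrow> i \<le> k \<or> i = Suc k" for i using k by auto
        moreover have "i \<le> k \<Longrightarrow> Suc i mod n = Suc i" for i using k by simp
        moreover have "Suc (Suc k) mod n = 0" "Suc (Suc k) = n" using k by simp_all
        ultimately show ?thesis by (metis One_nat_def Suc_eq_plus1)
      qed
      finally show ?thesis .
    qed
    moreover have "(\<Prod>i\<le>k. indicator (U i) (\<omega> (Suc i), \<omega> (Suc (Suc i)))) = 
      (if \<forall>i\<le>k. (\<omega> (Suc i), \<omega> (Suc (Suc i))) \<in> U i then 1 else 0 :: ennreal)"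
      by (auto simp: indicator_def)
    ultimately show "(\<Prod>i\<le>k. indicator (U i) (\<omega> (Suc i), \<omega> (Suc (Suc i)))) * ?g (\<omega> 1, \<omega> n)
      = indicator N \<omega>"
      using \<omega> by (auto simp: indicator_def N_def)
  qed
  also have "\<dots> = emeasure (\<Pi>\<^sub>M i\<in>{1..n}. M) N"
    by (rule nn_integral_indicator[OF N])
  also have "\<dots> = 0"
    unfolding N_def by (rule zero)
  finally have int0: "(\<integral>\<^sup>+x. \<integral>\<^sup>+z. path_kernel U k x z * ?g (x, z) \<partial>M \<partial>M) = 0" .
  note [measurable] = measurable_path_kernel[OF U, unfolded split_beta']
  have "AE x in M. (\<integral>\<^sup>+z. path_kernel U k x z * ?g (x, z) \<partial>M) = 0"
    using int0 by (subst (asm) nn_integral_0_iff_AE) simp_all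
  \<comment> \<open>For almost every first value, the points reachable at the other end can return
    to it only through the last event.\<close>
  then have good: "AE x in M. x \<in> space M \<and> (AE z in M. z \<in> reach U k x \<longrightarrow> (z, x) \<in> E (Suc k))"
    using AE_space
  proof eventually_elim
    case (elim x)
    note [measurable] = path_kernel_section[OF U elim(2)]
    have x[measurable]: "x \<in> space M" by fact
    have "AE z in M. path_kernel U k x z * indicator (U (Suc k)) (z, x) = 0"
      using elim(1) by (subst (asm) nn_integral_0_iff_AE) simp_all
    then have "AE z in M. z \<in> reach U k x \<longrightarrow> (z, x) \<in> E (Suc k)"
      by eventually_elim (use x k in \<open>auto simp: reach_def U_def indicator_def space_pair_measure split: if_splits\<close>)
    then show ?case using x by simp
  qed
  define u where "u x = prob (Pair x -` E 0)" for x
  define v where "v x = prob ((\<lambda>y. (y, x)) -` E (Suc k))" for x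
  have int: "integrable M u" "expectation u = measure (M \<Otimes>\<^sub>M M) (E 0)"
    "integrable M v" "expectation v = measure (M \<Otimes>\<^sub>M M) (E (Suc k))"
    unfolding u_def[abs_def] v_def[abs_def]
    by (rule expectation_section[OF measurable_emeasure_Pair[OF E0] emeasure_pair_measure_alt[OF E0, symmetric]]
        expectation_section[OF P.measurable_emeasure_Pair2[OF Ek] P.emeasure_pair_measure_alt2[OF Ek, symmetric]])+
  obtain x y w where x: "x \<in> space M" "AE z in M. z \<in> reach U k x \<longrightarrow> (z, x) \<in> E (Suc k)"
    and y: "y \<in> space M" "AE z in M. z \<in> reach U k y \<longrightarrow> (z, y) \<in> E (Suc k)"
    and w: "0 \<le> w" "w \<le> 1" and uv: "w * u x + (1 - w) * u y \<le> expectation u" "w * v x + (1 - w) * v y \<le> expectation v"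
    and le: "u y \<le> u x"
  proof -
    obtain x y w where *: "x \<in> space M \<and> (AE z in M. z \<in> reach U k x \<longrightarrow> (z, x) \<in> E (Suc k))"
      "y \<in> space M \<and> (AE z in M. z \<in> reach U k y \<longrightarrow> (z, y) \<in> E (Suc k))"
      "0 \<le> w" "w \<le> 1" "w * u x + (1 - w) * u y \<le> expectation u" "w * v x + (1 - w) * v y \<le> expectation v"
      using two_point_mixture[OF int(1,3) good] by blast
    show ?thesis
    \<comment> \<open>Exchanging the values together with their weights secures the order of the
      first reachable sets needed for nesting.\<close>
    proof (cases "u y \<le> u x")
      case True
      then show ?thesis using * that[of x y w] by blast
    next
      case False
      then show ?thesis using * that[of y x "1 - w"] by (auto simp: algebra_simps)
    qed
  qed
  have r0: "prob (reach U 0 s) = 1 - u s" if s: "s \<in> space M" for s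
  proof -
    have "reach U 0 s = space M - Pair s -` E 0"
      using s k by (auto simp: reach_def U_def indicator_def space_pair_measure split: if_splits)
    then show ?thesis using s by (simp add: u_def prob_compl sets_Pair1)
  qed
  have rk: "prob (reach U k s) \<le> v s" 
    if s: "s \<in> space M" "AE z in M. z \<in> reach U k s \<longrightarrow> (z, s) \<in> E (Suc k)" for s
    unfolding v_def
  proof (rule finite_measure_mono_AE)
    show "AE z in M. z \<in> reach U k s \<longrightarrow> z \<in> (\<lambda>y. (y, s)) -` E (Suc k)"
      using s(2) by eventually_elim auto
    show "(\<lambda>y. (y, s)) -` E (Suc k) \<in> events" by (rule sets_Pair2[OF Ek])
  qed
  show False
  proof (rule no_pair_of_chains[of k q "\<lambda>j. prob (reach U j x)" "\<lambda>j. prob (reach U j y)" w])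
    show "w * (1 - prob (reach U 0 x)) + (1 - w) * (1 - prob (reach U 0 y)) \<le> q 0"
      using uv(1) int(2) Eq[of 0] k r0 x y by simp
    have "w * prob (reach U k x) + (1 - w) * prob (reach U k y) \<le> w * v x + (1 - w) * v y"
      using w rk x y by (intro add_mono mult_left_mono) auto
    also have "\<dots> \<le> q (Suc k)" using uv(2) int(4) Eq[of "Suc k"] k by simp
    finally show "w * prob (reach U k x) + (1 - w) * prob (reach U k y) \<le> q (Suc k)" .
  next
    fix j assume "j < k"
    then have j: "Suc j < n" using k by simp
    have "AE p in M \<Otimes>\<^sub>M M. fst p \<in> reach U j s \<longrightarrow> snd p \<notin> reach U (Suc j) s \<longrightarrow> p \<in> E (Suc j)" if "s \<in> space M" for s
      using reach_step[of U s j, OF U that] AE_space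
      by eventually_elim (use j in \<open>auto simp: U_def\<close>)
    then have "prob (reach U j x) * (1 - prob (reach U (Suc j) x)) + prob (reach U j y) * (1 - prob (reach U (Suc j) y))
      - min (prob (reach U j x)) (prob (reach U j y)) * min (1 - prob (reach U (Suc j) x)) (1 - prob (reach U (Suc j) y))
      \<le> measure (M \<Otimes>\<^sub>M M) (E (Suc j))"
      using x y j by (intro measure_two_rectangles reach_sets U E) auto
    then show "prob (reach U j x) * (1 - prob (reach U (Suc j) x)) + prob (reach U j y) * (1 - prob (reach U (Suc j) y))
      - min (prob (reach U j x)) (prob (reach U j y)) * min (1 - prob (reach U (Suc j) x)) (1 - prob (reach U (Suc j) y))
      \<le> q (Suc j)"
      using Eq[OF j] by simp
  qed (use sub q per k w le r0 x y in auto)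
qed

end

subsection \<open>Scaling the levels\<close>

lemma level_tendsto_scaled:
  assumes "\<And>i'. i' < i \<Longrightarrow> 0 < level q j i'"
  shows "((\<lambda>r. level (\<lambda>i. r * q i) j i) \<longlongrightarrow> level q j i) (at 1 within S)"
  using assms
proof (induction i)
  case (Suc i)
  have "((\<lambda>r. 1 - r * q (j + i) / level (\<lambda>i. r * q i) j i) \<longlongrightarrow> 1 - 1 * q (j + i) / level q j i) (at 1 within S)"
    using Suc.prems[of i] by (intro tendsto_intros Suc) auto
  then show ?case by simp
qed simp

lemma subcritical_limit:
  assumes q: "\<And>i. 0 < q i" and sub: "\<And>r. 0 < r \<Longrightarrow> r < 1 \<Longrightarrow> subcritical n (\<lambda>i. r * q i)"
  shows "i < n \<Longrightarrow> 0 < level q j i" and "0 \<le> level q j n"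
proof -
  have ev: "\<forall>\<^sub>F r in at_left 1. 0 < r \<and> r < (1::real)"
    using eventually_at_left_real[of 0 1] by simp
  then have pos: "\<forall>\<^sub>F r in at_left 1. 0 < level (\<lambda>i. r * q i) j i" if "i \<le> n" for i
    by eventually_elim (use sub that in \<open>auto simp: subcritical_def\<close>)
  have 1: "0 < level q j i" if "i < n" for i
    using that
  proof (induction i rule: less_induct)
    case (less i)
    \<comment> \<open>Strictness survives the limit: positivity of the next level keeps the scaled
      level above \<open>r * q (j + i)\<close>, whose limit is positive. At \<open>i = n\<close> no
      next level is available.\<close>
    have "q (j + i) \<le> level q j i"
    proof (rule tendsto_le[OF trivial_limit_at_left_real])
      show "((\<lambda>r. level (\<lambda>i. r * q i) j i) \<longlongrightarrow> level q j i) (at_left 1)"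
        using less by (intro level_tendsto_scaled) auto
      have "((\<lambda>r. r * q (j + i)) \<longlongrightarrow> 1 * q (j + i)) (at_left 1)" by (intro tendsto_intros)
      then show "((\<lambda>r. r * q (j + i)) \<longlongrightarrow> q (j + i)) (at_left 1)" by simp
      show "\<forall>\<^sub>F r in at_left 1. r * q (j + i) \<le> level (\<lambda>i. r * q i) j i"
        using pos[OF less_imp_le[OF less.prems]] pos[OF Suc_leI[OF less.prems]]
        by eventually_elim simp
    qed
    then show ?case using q[of "j + i"] by simp
  qed
  then show "i < n \<Longrightarrow> 0 < level q j i" .
  show "0 \<le> level q j n"
  proof (rule tendsto_lowerbound[OF _ _ trivial_limit_at_left_real])
    show "((\<lambda>r. level (\<lambda>i. r * q i) j n) \<longlongrightarrow> level q j n) (at_left 1)"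
      using 1 by (intro level_tendsto_scaled) auto
    show "\<forall>\<^sub>F r in at_left 1. 0 \<le> level (\<lambda>i. r * q i) j n"
      using pos[OF order_refl] by eventually_elim simp
  qed
qed

text \<open>This leaves only \<open>n\<close> different cuts, so one scaling factor can serve all of
  them.\<close>

lemma level_mod:
  assumes "\<And>i. q (i + n) = q i"
  shows "level q (j mod n) i = level q j i"
proof -
  have "q (i + k * n) = q i" for i k
    using assms by (induction k) (auto simp: add.assoc[symmetric] add.commute[of n])
  from this[of _ "j div n"] have "q (j mod n + i) = q (j + i)" for i
    by (metis add.commute add.left_commute mult_div_mod_eq mult.commute)
  then show ?thesis by (induction i) auto
qed

lemma subcritical_open:
  assumes per: "\<And>i. q (i + n) = q i" and n: "0 < n" and sub: "subcritical n q"
  obtains \<epsilon> where "0 < \<epsilon>" "\<epsilon> < 1" "subcritical n (\<lambda>i. (1 + \<epsilon>) * q i)"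
proof -
  have "\<forall>\<^sub>F r in at_right 1. \<forall>j\<in>{..<n}. \<forall>i\<in>{..n}. 0 < level (\<lambda>i. r * q i) j i"
  proof (intro eventually_ball_finite ballI finite_lessThan finite_atMost)
    fix j i assume "i \<in> {..n}"
    then show "\<forall>\<^sub>F r in at_right 1. 0 < level (\<lambda>i. r * q i) j i"
      using sub by (intro order_tendstoD[OF level_tendsto_scaled]) (auto simp: subcritical_def)
  qed
  moreover have "\<forall>\<^sub>F r in at_right 1. r \<in> {1<..<2::real}"
    by (intro eventually_at_right_real) simp
  ultimately have "\<forall>\<^sub>F r in at_right 1. (\<forall>j<n. \<forall>i\<le>n. 0 < level (\<lambda>i. r * q i) j i) \<and> 1 < r \<and> r < (2::real)"
    by eventually_elim auto
  then obtain r :: real where r: "1 < r" "r < 2" "\<forall>j<n. \<forall>i\<le>n. 0 < level (\<lambda>i. r * q i) j i"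
    using eventually_happens'[OF trivial_limit_at_right_real] by blast
  have "subcritical n (\<lambda>i. r * q i)"
    unfolding subcritical_def
  proof safe
    fix j i assume "i \<le> n"
    then show "0 < level (\<lambda>i. r * q i) j i"
      using r(3) n level_mod[of "\<lambda>i. r * q i" n j i] per by (metis mod_less_divisor)
  qed
  then show ?thesis using r by (intro that[of "r - 1"]) auto
qed

subsection \<open>Cylinders in the cube\<close>

abbreviation unit_measure :: "real measure" where
  "unit_measure \<equiv> restrict_space lborel {0..1}"

lemma prob_space_unit: "prob_space unit_measure"
  by (rule prob_spaceI) (simp add: emeasure_restrict_space space_restrict_space)

lemma space_unit [simp]: "space unit_measure = {0..1}"
  by (simp add: space_restrict_space)

lemma emeasure_PiM_pair:
  assumes I: "finite I" "a \<in> I" "b \<in> I" "a \<noteq> b" and M: "prob_space M"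
    and E: "E \<in> sets (M \<Otimes>\<^sub>M M)"
  shows "emeasure (\<Pi>\<^sub>M i\<in>I. M) {\<omega> \<in> space (\<Pi>\<^sub>M i\<in>I. M). (\<omega> a, \<omega> b) \<in> E} = emeasure (M \<Otimes>\<^sub>M M) E"
proof -
  interpret M: prob_space M by fact
  interpret product_prob_space "\<lambda>_. M" I by standard
  note [measurable] = E
  let ?X = "{\<sigma> \<in> space (\<Pi>\<^sub>M i\<in>{a, b}. M). (\<sigma> a, \<sigma> b) \<in> E}"
  have X: "?X \<in> sets (\<Pi>\<^sub>M i\<in>{a, b}. M)" by measurable
  have "{\<omega> \<in> space (\<Pi>\<^sub>M i\<in>I. M). (\<omega> a, \<omega> b) \<in> E} = prod_emb I (\<lambda>_. M) {a, b} ?X"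
    using I by (auto simp: prod_emb_def space_PiM restrict_PiE_iff)
  then have "emeasure (\<Pi>\<^sub>M i\<in>I. M) {\<omega> \<in> space (\<Pi>\<^sub>M i\<in>I. M). (\<omega> a, \<omega> b) \<in> E} = emeasure (\<Pi>\<^sub>M i\<in>{a, b}. M) ?X"
    using X I by (simp add: emeasure_PiM_emb')
  also have "\<dots> = (\<integral>\<^sup>+\<sigma>. indicator ?X \<sigma> \<partial>(\<Pi>\<^sub>M i\<in>{a, b}. M))"
    by (rule nn_integral_indicator[OF X, symmetric])
  also have "\<dots> = (\<integral>\<^sup>+\<sigma>. indicator E (\<sigma> a, \<sigma> b) \<partial>(\<Pi>\<^sub>M i\<in>{a, b}. M))"
    by (intro nn_integral_cong) (simp add: indicator_def)
  also have "\<dots> = (\<integral>\<^sup>+z. indicator E (fst z, snd z) \<partial>(M \<Otimes>\<^sub>M M))"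
    using product_nn_integral_pair[of "\<lambda>x y. indicator E (x, y)" a b] I by simp
  finally show ?thesis by simp
qed

lemma nbhd_cyclic:
  assumes "v \<in> {1..n}"
  shows "nbhd (cyclic_bigraph n) v = {v, v mod n + 1}"
  using assms by (auto simp: nbhd_def cyclic_bigraph_def Suc_le_eq)

lemma cyclic_bigraph_sel [simp]:
  "nleft (cyclic_bigraph n) = n" "nright (cyclic_bigraph n) = n"
  by (simp_all add: cyclic_bigraph_def)

lemma prob_space_cube: "prob_space (cube V)"
proof -
  interpret P: prob_space "\<Pi>\<^sub>M v\<in>V. unit_measure" by (rule prob_space_PiM) (rule prob_space_unit)
  show ?thesis unfolding cube_def
    by (rule prob_spaceI) (simp add: P.emeasure_space_1)
qed

lemma space_cube: "space (cube V) = V \<rightarrow>\<^sub>E {0..1}"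
  by (simp add: cube_def space_PiM)

lemma successor_neq:
  fixes n v :: nat
  assumes "2 \<le> n" "v \<in> {1..n}"
  shows "v mod n + 1 \<in> {1..n}" "v \<noteq> v mod n + 1"
proof -
  have "v mod n < n" using assms by simp
  then show "v mod n + 1 \<in> {1..n}" by simp
  consider "v = n" | "v < n" using assms by fastforce
  then show "v \<noteq> v mod n + 1" using assms by cases auto
qed

text \<open>The base of a cylinder is measurable only for the completion. Enlarging it by a Borel
  null set gives a set in the plain product, where Fubini applies, at no cost in measure.\<close>

lemma borel_hull_of_cylinder:
  assumes I: "finite I" "a \<in> I" "b \<in> I" "a \<noteq> b" and B: "B \<in> sets (cube {a, b})"
    and A: "prod_emb I (\<lambda>_. unit_measure) {a, b} B \<in> sets (cube I)"
  obtains E where "E \<in> sets (unit_measure \<Otimes>\<^sub>M unit_measure)"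
    "measure (unit_measure \<Otimes>\<^sub>M unit_measure) E \<le> measure (cube I) (prod_emb I (\<lambda>_. unit_measure) {a, b} B)"
    "\<And>\<omega>. \<omega> \<in> prod_emb I (\<lambda>_. unit_measure) {a, b} B \<Longrightarrow> (\<omega> a, \<omega> b) \<in> E"
proof -
  let ?u = unit_measure
  interpret M: prob_space ?u by (rule prob_space_unit)
  interpret PP: pair_prob_space ?u ?u ..
  interpret product_prob_space "\<lambda>_. ?u" I by standard
  interpret C: prob_space "cube I" by (rule prob_space_cube)
  let ?J = "\<Pi>\<^sub>M i\<in>{a, b}. ?u"
  obtain S N N' where S: "B = S \<union> N'" "N' \<subseteq> N" "N \<in> null_sets ?J" "S \<in> sets ?J"
    using B unfolding cube_def by (elim sets_completionE)
  define f :: "real \<times> real \<Rightarrow> nat \<Rightarrow> real" where "f z = (\<lambda>i\<in>{a, b}. if i = a then fst z else snd z)" for z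
  have f[measurable]: "f \<in> ?u \<Otimes>\<^sub>M ?u \<rightarrow>\<^sub>M ?J"
    unfolding f_def[abs_def] by (rule measurable_restrict) auto
  have SN[measurable]: "S \<union> N \<in> sets ?J" using S by auto
  define E where "E = {z \<in> space (?u \<Otimes>\<^sub>M ?u). f z \<in> S \<union> N}"
  have E: "E \<in> sets (?u \<Otimes>\<^sub>M ?u)" unfolding E_def by measurable
  have fr: "f (\<omega> a, \<omega> b) = restrict \<omega> {a, b}" for \<omega>
    using I by (auto simp: f_def restrict_def fun_eq_iff)
  have "emeasure (?u \<Otimes>\<^sub>M ?u) E = emeasure (\<Pi>\<^sub>M i\<in>I. ?u) {\<omega> \<in> space (\<Pi>\<^sub>M i\<in>I. ?u). (\<omega> a, \<omega> b) \<in> E}"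
    using emeasure_PiM_pair[OF I prob_space_unit E] by simp
  also have "{\<omega> \<in> space (\<Pi>\<^sub>M i\<in>I. ?u). (\<omega> a, \<omega> b) \<in> E} = prod_emb I (\<lambda>_. ?u) {a, b} (S \<union> N)"
    using I by (auto simp: E_def fr prod_emb_def space_PiM space_pair_measure)
  also have "emeasure (\<Pi>\<^sub>M i\<in>I. ?u) \<dots> = emeasure ?J (S \<union> N)"
    using I by (intro emeasure_PiM_emb' SN) auto
  also have "\<dots> = emeasure ?J S" using S by (simp add: emeasure_Un_null_set)
  also have "\<dots> = emeasure (\<Pi>\<^sub>M i\<in>I. ?u) (prod_emb I (\<lambda>_. ?u) {a, b} S)"
    using I S by (intro emeasure_PiM_emb'[symmetric]) auto
  also have "\<dots> = emeasure (cube I) (prod_emb I (\<lambda>_. ?u) {a, b} S)"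
    using I S by (simp add: cube_def)
  also have "\<dots> \<le> emeasure (cube I) (prod_emb I (\<lambda>_. ?u) {a, b} B)"
    using S(1) A by (intro emeasure_mono prod_emb_mono) auto
  finally have le: "measure (?u \<Otimes>\<^sub>M ?u) E \<le> measure (cube I) (prod_emb I (\<lambda>_. ?u) {a, b} B)"
    by (simp add: PP.P.emeasure_eq_measure C.emeasure_eq_measure)
  show ?thesis
  proof (rule that[OF E le])
    fix \<omega> assume "\<omega> \<in> prod_emb I (\<lambda>_. ?u) {a, b} B"
    then show "(\<omega> a, \<omega> b) \<in> E"
      using S(1,2) I by (auto simp: E_def fr prod_emb_def space_pair_measure)
  qed
qed

subsection \<open>Interior and boundary of the cycle\<close>

text \<open>The edge of index \<open>i\<close>, counted from 0, belongs to the left vertex \<open>i + 1\<close>.\<close>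

definition cyclic_weight :: "nat \<Rightarrow> (nat \<Rightarrow> real) \<Rightarrow> nat \<Rightarrow> real" where
  "cyclic_weight n p i = p (i mod n + 1)"

lemma cyclic_weight_mem:
  assumes "p \<in> {1..n} \<rightarrow> X" "0 < n"
  shows "cyclic_weight n p i \<in> X"
proof -
  have "i mod n + 1 \<in> {1..n}" using assms(2) by (simp add: Suc_le_eq)
  then show ?thesis using assms(1) unfolding cyclic_weight_def by (rule funcset_mem[rotated])
qed

lemma cyclic_weight_periodic: "cyclic_weight n p (i + n) = cyclic_weight n p i"
  by (simp add: cyclic_weight_def)

lemma subcritical_imp_interior:
  assumes n: "3 \<le> n" and p: "p \<in> {1..n} \<rightarrow> {0<..<1}" and sub: "subcritical n (cyclic_weight n p)"
  shows "p \<in> bigraph_interior (cyclic_bigraph n)"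
  unfolding bigraph_interior_def cyclic_bigraph_sel
proof (intro CollectI conjI p allI impI, elim conjE)
  fix A
  assume conf: "A \<sim>\<^sub>c cyclic_bigraph n" and meas: "\<forall>i\<in>{1..n}. measure (cube {1..n}) (A i) = p i"
  let ?u = unit_measure and ?s = "\<lambda>v. v mod n + 1"
  interpret M: prob_space ?u by (rule prob_space_unit)
  interpret C: prob_space "cube {1..n}" by (rule prob_space_cube)
  \<comment> \<open>\<open>measure\<close> is 0 outside the sigma-algebra, so a positive value
    forces measurability.\<close>
  have Asets: "A v \<in> sets (cube {1..n})" if "v \<in> {1..n}" for v
    using meas p that by (metis PiE_iff Pi_iff greaterThanLessThan_iff less_irrefl measure_notin_sets)
  have "\<exists>E. E \<in> sets (?u \<Otimes>\<^sub>M ?u) \<and> measure (?u \<Otimes>\<^sub>M ?u) E \<le> p v \<and>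
    (\<forall>\<omega>\<in>A v. (\<omega> v, \<omega> (?s v)) \<in> E)" if v: "v \<in> {1..n}" for v
  proof -
    obtain B where B: "B \<in> sets (cube {v, ?s v})" "A v = prod_emb {1..n} (\<lambda>_. ?u) {v, ?s v} B"
      using conf v unfolding conforms_def cyclic_bigraph_sel by (metis nbhd_cyclic[OF v])
    obtain E where "E \<in> sets (?u \<Otimes>\<^sub>M ?u)" "measure (?u \<Otimes>\<^sub>M ?u) E \<le> measure (cube {1..n}) (A v)"
      "\<And>\<omega>. \<omega> \<in> A v \<Longrightarrow> (\<omega> v, \<omega> (?s v)) \<in> E"
      using borel_hull_of_cylinder[of "{1..n}" v "?s v" B] B Asets[OF v] successor_neq[of n v] n v by auto
    then show ?thesis using meas v by auto
  qed
  then obtain E where E: "\<And>v. v \<in> {1..n} \<Longrightarrow> E v \<in> sets (?u \<Otimes>\<^sub>M ?u)"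
    "\<And>v. v \<in> {1..n} \<Longrightarrow> measure (?u \<Otimes>\<^sub>M ?u) (E v) \<le> p v"
    "\<And>v \<omega>. v \<in> {1..n} \<Longrightarrow> \<omega> \<in> A v \<Longrightarrow> (\<omega> v, \<omega> (?s v)) \<in> E v"
    by metis
  define N where "N = {\<omega> \<in> space (\<Pi>\<^sub>M i\<in>{1..n}. ?u). \<forall>i<n. (\<omega> (Suc i), \<omega> (?s (Suc i))) \<notin> E (Suc i)}"
  have "emeasure (\<Pi>\<^sub>M i\<in>{1..n}. ?u) N \<noteq> 0"
    unfolding N_def
  proof (rule M.cyclic_uncovered_pos[OF sub])
    show "0 < cyclic_weight n p i" for i
      using cyclic_weight_mem[OF p] n by auto
  qed (use E n in \<open>auto simp: cyclic_weight_def\<close>)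
  moreover from this have "N \<in> sets (\<Pi>\<^sub>M i\<in>{1..n}. ?u)" by (metis emeasure_notin_sets)
  ultimately have "0 < emeasure (cube {1..n}) N"
    by (simp add: cube_def zero_less_iff_neq_zero)
  also have "\<dots> \<le> emeasure (cube {1..n}) (space (cube {1..n}) \<inter> (\<Inter>i\<in>{1..n}. space (cube {1..n}) - A i))"
  proof (rule emeasure_mono)
    show "N \<subseteq> space (cube {1..n}) \<inter> (\<Inter>i\<in>{1..n}. space (cube {1..n}) - A i)"
    proof (intro subsetI IntI INT_I DiffI)
      fix \<omega> assume "\<omega> \<in> N"
      then show sp: "\<omega> \<in> space (cube {1..n})" "\<omega> \<in> space (cube {1..n})"
        by (auto simp: N_def cube_def)
      fix i assume i: "i \<in> {1..n}"
      show "\<omega> \<notin> A i"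
        using \<open>\<omega> \<in> N\<close> E(3)[OF i, of \<omega>] i by (auto simp: N_def Suc_le_eq dest!: spec[of _ "i - 1"])
    qed
    show "space (cube {1..n}) \<inter> (\<Inter>i\<in>{1..n}. space (cube {1..n}) - A i) \<in> sets (cube {1..n})"
      using Asets n by (intro sets.Int sets.finite_INT) auto
  qed
  finally show "0 < measure (cube {1..n}) (space (cube {1..n}) \<inter> (\<Inter>i\<in>{1..n}. space (cube {1..n}) - A i))"
    by (simp only: C.emeasure_eq_measure ennreal_less_zero_iff)
qed

text \<open>An interval of length \<open>t\<close> whose two degenerate cases are exactly the empty set and the whole of
  \<open>[0,1]\<close>, endpoints included.\<close>

definition upper :: "real \<Rightarrow> real set" where
  "upper t = {x \<in> {0..1}. t \<noteq> 0 \<and> 1 - t \<le> x}"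

lemma upper_simps [simp]: "upper 0 = {}" "upper 1 = {0..1}"
  by (auto simp: upper_def)

lemma upper_mono: "0 \<le> s \<Longrightarrow> s \<le> t \<Longrightarrow> upper s \<subseteq> upper t"
  by (auto simp: upper_def)

lemma upper_measure:
  assumes "0 \<le> t" "t \<le> 1"
  shows "upper t \<in> sets unit_measure" "measure unit_measure (upper t) = t"
proof -
  have *: "upper t = (if t = 0 then {} else {1 - t..1})" using assms by (auto simp: upper_def)
  then show "upper t \<in> sets unit_measure"
    using assms by (auto simp: sets_restrict_space_iff)
  show "measure unit_measure (upper t) = t"
    unfolding * using assms by (auto simp: measure_restrict_space)
qed

text \<open>An exclusive event: where coordinate \<open>a\<close> lies in the still uncovered part
  \<open>upper s\<close>, it leaves only \<open>upper t\<close> uncovered in coordinate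
  \<open>b\<close>.\<close>

definition staircase :: "nat set \<Rightarrow> nat \<Rightarrow> nat \<Rightarrow> real \<Rightarrow> real \<Rightarrow> (nat \<Rightarrow> real) set" where
  "staircase I a b s t = {\<omega> \<in> I \<rightarrow>\<^sub>E {0..1}. \<omega> a \<in> upper s \<and> \<omega> b \<notin> upper t}"

lemma staircase_cylinder:
  assumes I: "finite I" "a \<in> I" "b \<in> I" "a \<noteq> b" and st: "0 \<le> s" "s \<le> 1" "0 \<le> t" "t \<le> 1"
  shows "measure (cube I) (staircase I a b s t) = s * (1 - t)"
    and "\<exists>B\<in>sets (cube {a, b}). staircase I a b s t = prod_emb I (\<lambda>_. unit_measure) {a, b} B"
proof -
  let ?u = unit_measure
  interpret M: prob_space ?u by (rule prob_space_unit)
  interpret P: prob_space "\<Pi>\<^sub>M v\<in>I. ?u" by (rule prob_space_PiM) (rule prob_space_unit)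
  note [measurable] = upper_measure(1)[OF st(1,2)] upper_measure(1)[OF st(3,4)]
  have alt: "staircase I a b s t = {\<omega> \<in> space (\<Pi>\<^sub>M i\<in>I. ?u). \<omega> a \<in> upper s \<and> \<omega> b \<notin> upper t}" for I
    by (auto simp: staircase_def space_PiM)
  have R: "upper s \<times> (space ?u - upper t) \<in> sets (?u \<Otimes>\<^sub>M ?u)" by measurable
  have "staircase I a b s t = {\<omega> \<in> space (\<Pi>\<^sub>M i\<in>I. ?u). (\<omega> a, \<omega> b) \<in> upper s \<times> (space ?u - upper t)}"
    using I by (auto simp: alt space_PiM)
  then have "emeasure (\<Pi>\<^sub>M i\<in>I. ?u) (staircase I a b s t) = emeasure (?u \<Otimes>\<^sub>M ?u) (upper s \<times> (space ?u - upper t))"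
    using emeasure_PiM_pair[OF I prob_space_unit R] by (simp only:)
  also have "\<dots> = emeasure ?u (upper s) * emeasure ?u (space ?u - upper t)"
    by (intro M.emeasure_pair_measure_Times) measurable
  also have "\<dots> = ennreal (s * (1 - t))"
    using upper_measure[OF st(1,2)] upper_measure[OF st(3,4)] st
    by (simp add: M.emeasure_eq_measure M.prob_compl[simplified] ennreal_mult)
  finally have e: "emeasure (\<Pi>\<^sub>M i\<in>I. ?u) (staircase I a b s t) = ennreal (s * (1 - t))" .
  have S: "staircase I a b s t \<in> sets (\<Pi>\<^sub>M i\<in>I. ?u)" if "a \<in> I" "b \<in> I" for I
    unfolding alt using that by measurable
  show "measure (cube I) (staircase I a b s t) = s * (1 - t)"
    unfolding cube_def using e S[of I] I st by (simp add: P.emeasure_eq_measure)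
  show "\<exists>B\<in>sets (cube {a, b}). staircase I a b s t = prod_emb I (\<lambda>_. ?u) {a, b} B"
  proof
    show "staircase {a, b} a b s t \<in> sets (cube {a, b})"
      unfolding cube_def using S[of "{a, b}"] by simp
    show "staircase I a b s t = prod_emb I (\<lambda>_. ?u) {a, b} (staircase {a, b} a b s t)"
      using I by (auto simp: prod_emb_def staircase_def)
  qed
qed

section \<open>Discreteness from invariance in one coordinate\<close>

lemma discrete_in_dimI:
  assumes A: "A \<subseteq> {1..m} \<rightarrow>\<^sub>E {0..1}" and c: "c \<in> {1..m}"
    and \<Delta>: "\<And>k. k \<in> {1..d} \<Longrightarrow> is_interval (\<Delta> k) \<and> \<Delta> k \<noteq> {}" "disjoint_family_on \<Delta> {1..d}"
      "(\<Union>k\<in>{1..d}. \<Delta> k) = {0..1}"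
    and inv: "\<And>k f x. k \<in> {1..d} \<Longrightarrow> f \<in> A \<Longrightarrow> f c \<in> \<Delta> k \<Longrightarrow> x \<in> \<Delta> k \<Longrightarrow> f(c := x) \<in> A"
  shows "discrete_in_dim m d c A"
proof -
  define S where "S k = {y \<in> ({1..m} - {c}) \<rightarrow>\<^sub>E {0..1::real}. \<exists>t\<in>\<Delta> k. y(c := t) \<in> A}" for k
  have "A = (\<Union>k\<in>{1..d}. {y(c := t) | y t. y \<in> S k \<and> t \<in> \<Delta> k})"
  proof (intro equalityI subsetI)
    fix f assume f: "f \<in> A"
    then have "f c \<in> {0..1}" using A c by (metis PiE_mem subsetD)
    then obtain k where k: "k \<in> {1..d}" "f c \<in> \<Delta> k" using \<Delta>(3) by blast
    have "insert c ({1..m} - {c}) = {1..m}" using c by auto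
    then have "f(c := undefined) \<in> ({1..m} - {c}) \<rightarrow>\<^sub>E {0..1}"
      using A f by (intro fun_upd_in_PiE) auto
    moreover have id: "f = (f(c := undefined))(c := f c)" by simp
    then have "\<exists>t\<in>\<Delta> k. (f(c := undefined))(c := t) \<in> A" using f k(2) by metis
    ultimately have "f(c := undefined) \<in> S k" unfolding S_def by blast
    with id k show "f \<in> (\<Union>k\<in>{1..d}. {y(c := t) | y t. y \<in> S k \<and> t \<in> \<Delta> k})"
      by blast
  next
    fix f assume "f \<in> (\<Union>k\<in>{1..d}. {y(c := t) | y t. y \<in> S k \<and> t \<in> \<Delta> k})"
    then obtain k y t t' where "k \<in> {1..d}" "f = y(c := t)" "t \<in> \<Delta> k" "t' \<in> \<Delta> k" "y(c := t') \<in> A"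
      by (auto simp: S_def)
    then show "f \<in> A" using inv[of k "y(c := t')" t] by simp
  qed
  moreover have "S k \<subseteq> ({1..m} - {c}) \<rightarrow>\<^sub>E {0..1}" for k by (auto simp: S_def)
  ultimately show ?thesis
    unfolding discrete_in_dim_def using \<Delta> by (intro exI[of _ \<Delta>] exI[of _ S]) auto
qed

lemma discrete_in_dim_one:
  assumes "A \<subseteq> {1..m} \<rightarrow>\<^sub>E {0..1}" "c \<in> {1..m}"
    and "\<And>f x. f \<in> A \<Longrightarrow> x \<in> {0..1} \<Longrightarrow> f(c := x) \<in> A"
  shows "discrete_in_dim m 1 c A"
  using assms
  by (intro discrete_in_dimI[where \<Delta> = "\<lambda>_. {0..1}"]) (auto simp: disjoint_family_on_def is_interval_cc)

lemma discrete_in_dim_two: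
  assumes A: "A \<subseteq> {1..m} \<rightarrow>\<^sub>E {0..1}" "c \<in> {1..m}" and t: "0 < t" "t < 1"
    and inv: "\<And>f x. f \<in> A \<Longrightarrow> x \<in> {0..1} \<Longrightarrow> f c \<in> upper t \<longleftrightarrow> x \<in> upper t \<Longrightarrow> f(c := x) \<in> A"
  shows "discrete_in_dim m 2 c A"
\<comment> \<open>Both pieces must be nonempty, which is where \<open>0 < t\<close> and
  \<open>t < 1\<close> enter; the cut point goes to the upper piece as in
  \<open>upper\<close>.\<close>
proof (rule discrete_in_dimI[where \<Delta> = "\<lambda>k. if k = 1 then {0..<1-t} else {1-t..1}"])
  show "disjoint_family_on (\<lambda>k. if k = 1 then {0..<1-t} else {1-t..1}) {1..2::nat}"
    by (auto simp: disjoint_family_on_def split: if_splits)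
  have "{1..2::nat} = {1, 2}" by auto
  then show "(\<Union>k\<in>{1..2::nat}. if k = 1 then {0..<1-t} else {1-t..1}) = {0..1}"
    using t by auto
  show "is_interval (if k = 1 then {0..<1-t} else {1-t..1}) \<and> (if k = 1 then {0..<1-t} else {1-t..1}) \<noteq> {}" for k :: nat
    using t by (auto simp: is_interval_cc is_interval_co)
  show "f(c := x) \<in> A" if "f \<in> A" "f c \<in> (if k = 1 then {0..<1-t} else {1-t..1})"
    "x \<in> (if k = 1 then {0..<1-t} else {1-t..1})" for k :: nat and f x
    using that t by (intro inv) (auto simp: upper_def split: if_splits)
qed (use A in auto)


section \<open>Covering families read off from a cut\<close>

definition rotation :: "nat \<Rightarrow> nat \<Rightarrow> nat \<Rightarrow> nat" where
  "rotation n j i = (j + i) mod n + 1"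

lemma rotation_Suc: "rotation n j (Suc i) = rotation n j i mod n + 1"
  by (simp add: rotation_def mod_Suc_eq)

lemma rotation_full: "rotation n j n = rotation n j 0"
  by (simp add: rotation_def)

lemma bij_rotation:
  assumes "0 < n"
  shows "bij_betw (rotation n j) {..<n} {1..n}"
proof -
  have *: "i = i'" if "i' \<le> i" "i < n" "rotation n j i = rotation n j i'" for i i'
  proof -
    have "n dvd (j + i) - (j + i')"
      using that by (subst mod_eq_dvd_iff_nat[symmetric]) (auto simp: rotation_def)
    then show ?thesis using that by (auto dest: dvd_imp_le)
  qed
  have "inj_on (rotation n j) {..<n}"
    using * by (intro inj_onI) (metis lessThan_iff nle_le)
  moreover have "rotation n j ` {..<n} = {1..n}"
  proof (rule card_subset_eq)
    show "rotation n j ` {..<n} \<subseteq> {1..n}"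
      using assms by (auto simp: rotation_def Suc_le_eq)
    show "card (rotation n j ` {..<n}) = card {1..n}"
      using card_image[OF calculation] by simp
  qed simp
  ultimately show ?thesis by (simp add: bij_betw_def)
qed

text \<open>At position \<open>i\<close> after the cut, \<open>\<tau> i\<close> is the width left
  uncovered and \<open>\<sigma> i\<close> the width on which the next event acts. An uncovered point
  would pass from \<open>upper (\<tau> i)\<close> into \<open>upper (\<sigma> i)\<close> and on to
  the next position until it had a coordinate in \<open>upper 0\<close>, which is empty. Two
  sequences are needed because the levels can fail to be positive before the round is
  complete.\<close>

lemma staircase_family:
  fixes \<sigma> \<tau> :: "nat \<Rightarrow> real"
  assumes n: "2 \<le> n" and l: "l \<le> n"
    and \<sigma>: "\<And>i. i < n \<Longrightarrow> 0 \<le> \<sigma> i \<and> \<sigma> i \<le> 1" and \<tau>: "\<And>i. i \<le> n \<Longrightarrow> 0 \<le> \<tau> i \<and> \<tau> i \<le> 1"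
    and start: "\<sigma> 0 = 1" and stop: "\<tau> l = 0"
    and mono: "\<And>i. 0 < i \<Longrightarrow> i < l \<Longrightarrow> \<tau> i \<le> \<sigma> i"
  obtains A where "A \<sim>\<^sub>c cyclic_bigraph n"
    "\<And>i. i < n \<Longrightarrow> A (rotation n j i) = staircase {1..n} (rotation n j i) (rotation n j (Suc i)) (\<sigma> i) (\<tau> (Suc i))"
    "\<And>i. i < n \<Longrightarrow> measure (cube {1..n}) (A (rotation n j i)) = \<sigma> i * (1 - \<tau> (Suc i))"
    "l \<noteq> 0 \<Longrightarrow> (\<Union>v\<in>{1..n}. A v) = {1..n} \<rightarrow>\<^sub>E {0..1}"
proof -
  have bij: "bij_betw (rotation n j) {..<n} {1..n}" using n by (intro bij_rotation) simp
  define A where "A v = staircase {1..n} v (v mod n + 1) (\<sigma> (inv_into {..<n} (rotation n j) v))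
    (\<tau> (Suc (inv_into {..<n} (rotation n j) v)))" for v
  have A: "A (rotation n j i) = staircase {1..n} (rotation n j i) (rotation n j (Suc i)) (\<sigma> i) (\<tau> (Suc i))"
    if "i < n" for i
    using bij_betw_inv_into_left[OF bij, of i] that by (simp add: A_def rotation_Suc)
  have rot: "rotation n j i \<in> {1..n}" if "i < n" for i using bij_betwE[OF bij] that by blast
  have onto: "\<exists>i<n. v = rotation n j i" if "v \<in> {1..n}" for v
    using bij that unfolding bij_betw_def by (metis imageE lessThan_iff)
  note cyl = staircase_cylinder[of "{1..n}" "rotation n j i" "rotation n j (Suc i)" "\<sigma> i" "\<tau> (Suc i)" for i]
  have side: "rotation n j (Suc i) \<in> {1..n}" "rotation n j i \<noteq> rotation n j (Suc i)" if "i < n" for i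
    using successor_neq[OF n rot[OF that]] by (simp_all add: rotation_Suc)
  show ?thesis
  proof (rule that)
    show "A \<sim>\<^sub>c cyclic_bigraph n"
      unfolding conforms_def cyclic_bigraph_sel
    proof
      fix v assume "v \<in> {1..n}"
      then obtain i where i: "i < n" "v = rotation n j i" using onto by blast
      show "\<exists>B\<in>sets (cube (nbhd (cyclic_bigraph n) v)).
          A v = prod_emb {1..n} (\<lambda>_. unit_measure) (nbhd (cyclic_bigraph n) v) B"
        unfolding i(2) nbhd_cyclic[OF rot[OF i(1)], folded rotation_Suc] A[OF i(1)]
        using i \<sigma>[of i] \<tau>[of "Suc i"] rot side by (intro cyl(2)) auto
    qed
    show "measure (cube {1..n}) (A (rotation n j i)) = \<sigma> i * (1 - \<tau> (Suc i))" if "i < n" for i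
      unfolding A[OF that] using that \<sigma>[of i] \<tau>[of "Suc i"] rot side by (intro cyl(1)) auto
    show "(\<Union>v\<in>{1..n}. A v) = {1..n} \<rightarrow>\<^sub>E {0..1}" if l0: "l \<noteq> 0"
    proof (intro equalityI subsetI)
      fix f :: "nat \<Rightarrow> real" assume f: "f \<in> {1..n} \<rightarrow>\<^sub>E {0..1}"
      show "f \<in> (\<Union>v\<in>{1..n}. A v)"
      proof (rule ccontr)
        assume "f \<notin> (\<Union>v\<in>{1..n}. A v)"
        then have un: "f (rotation n j (Suc i)) \<in> upper (\<tau> (Suc i))"
          if "i < n" "f (rotation n j i) \<in> upper (\<sigma> i)" for i
          using that rot[of i] A[of i] f by (auto simp: staircase_def)
        have "f (rotation n j (Suc i)) \<in> upper (\<tau> (Suc i))" if "i < l" for i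
          using that
        proof (induction i)
          case 0
          show ?case
            using f rot[of 0] n start by (intro un) (auto simp: PiE_mem)
        next
          case (Suc i)
          have "upper (\<tau> (Suc i)) \<subseteq> upper (\<sigma> (Suc i))"
            using Suc.prems l \<tau>[of "Suc i"] mono[of "Suc i"] by (intro upper_mono) auto
          then show ?case using Suc l by (intro un) auto
        qed
        from this[of "l - 1"] show False using l0 stop by simp
      qed
    qed (auto simp: A_def staircase_def)
  qed (use A in auto)
qed

lemma level_le_one:
  assumes "\<And>i. 0 \<le> q i" "\<And>i'. i' < i \<Longrightarrow> 0 < level q j i'"
  shows "level q j i \<le> 1"
  using assms by (cases i) (auto intro!: divide_nonneg_pos)

lemma cyclic_weight_rotation: "cyclic_weight n p (j + i) = p (rotation n j i)"
  by (simp add: cyclic_weight_def rotation_def)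

text \<open>Cutting the cycle at a vertex and letting each event occupy exactly the part of the cube left
  uncovered by its predecessors exhausts the cube as soon as a level is nonpositive.\<close>

lemma level_nonpos_family:
  fixes n p defines "q \<equiv> cyclic_weight n p"
  assumes n: "2 \<le> n" and p: "p \<in> {1..n} \<rightarrow> {0<..<1}" and l: "l \<le> n"
    and pos: "\<And>i. i < l \<Longrightarrow> 0 < level q j i" and npos: "level q j l \<le> 0"
  obtains A where "A \<sim>\<^sub>c cyclic_bigraph n" "\<And>v. v \<in> {1..n} \<Longrightarrow> measure (cube {1..n}) (A v) = p v"
    "(\<Union>v\<in>{1..n}. A v) = {1..n} \<rightarrow>\<^sub>E {0..1}"
    "\<And>i. l = n \<Longrightarrow> level q j n = 0 \<Longrightarrow> i < n \<Longrightarrow>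
      A (rotation n j i) = staircase {1..n} (rotation n j i) (rotation n j (Suc i)) (level q j i) (level q j (Suc i))"
proof -
  have q: "0 < q i" "q i < 1" for i
    using cyclic_weight_mem[OF p, of i] n by (auto simp: q_def)
  \<comment> \<open>The first level is \<open>1 - q j\<close>, which is positive; hence the event at
    the cut acts on its whole first coordinate, \<open>\<sigma> 0 = 1\<close>.\<close>
  have l2: "2 \<le> l"
  proof (rule ccontr)
    assume "\<not> 2 \<le> l"
    then have "l = 0 \<or> l = Suc 0" by linarith
    then show False using npos q[of j] by auto
  qed
  have le1: "level q j i \<le> 1" if "i \<le> l" for i
    using that q pos by (intro level_le_one) (auto intro: less_imp_le)
  \<comment> \<open>From event \<open>l - 1\<close> on nothing is left uncovered, so the prescribed
    measure makes the width equal to the weight. Event \<open>l - 1\<close> is wide enough, since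
    \<open>level q j l \<le> 0\<close> says that its weight is at least the preceding level.\<close>
  define \<sigma> where "\<sigma> i = (if Suc i < l then level q j i else q (j + i))" for i
  define \<tau> where "\<tau> i = (if i < l then level q j i else 0)" for i
  have prod: "\<sigma> i * (1 - \<tau> (Suc i)) = q (j + i)" for i
    using pos[of i] by (auto simp: \<sigma>_def \<tau>_def)
  obtain A where A: "A \<sim>\<^sub>c cyclic_bigraph n"
    "\<And>i. i < n \<Longrightarrow> A (rotation n j i) = staircase {1..n} (rotation n j i) (rotation n j (Suc i)) (\<sigma> i) (\<tau> (Suc i))"
    "\<And>i. i < n \<Longrightarrow> measure (cube {1..n}) (A (rotation n j i)) = \<sigma> i * (1 - \<tau> (Suc i))"
    "l \<noteq> 0 \<Longrightarrow> (\<Union>v\<in>{1..n}. A v) = {1..n} \<rightarrow>\<^sub>E {0..1}"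
  proof (rule staircase_family[of n l \<sigma> \<tau> j])
    show "0 \<le> \<sigma> i \<and> \<sigma> i \<le> 1" if "i < n" for i
      using pos[of i] le1[of i] q[of "j + i"] by (auto simp: \<sigma>_def)
    show "0 \<le> \<tau> i \<and> \<tau> i \<le> 1" if "i \<le> n" for i
      using pos[of i] le1[of i] by (auto simp: \<tau>_def)
    show "\<tau> i \<le> \<sigma> i" if "0 < i" "i < l" for i
    proof (cases "Suc i < l")
      case False
      then have "Suc i = l" using that by simp
      then have "level q j (Suc i) \<le> 0" using npos by simp
      then show ?thesis using that False pos[of i] by (simp add: \<sigma>_def \<tau>_def le_divide_eq)
    qed (use that in \<open>simp add: \<sigma>_def \<tau>_def\<close>)
  qed (use n l l2 in \<open>auto simp: \<sigma>_def \<tau>_def\<close>)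
  show ?thesis
  proof (rule that[OF A(1)])
    show "measure (cube {1..n}) (A v) = p v" if v: "v \<in> {1..n}" for v
    proof -
      obtain i where "i < n" "v = rotation n j i"
        using v bij_rotation[of n j] n unfolding bij_betw_def by fastforce
      then show ?thesis
        using A(3)[of i] prod[of i] by (simp add: q_def cyclic_weight_rotation)
    qed
    show "(\<Union>v\<in>{1..n}. A v) = {1..n} \<rightarrow>\<^sub>E {0..1}" using A(4) l2 by simp
    show "A (rotation n j i) = staircase {1..n} (rotation n j i) (rotation n j (Suc i)) (level q j i) (level q j (Suc i))"
      if "l = n" "level q j n = 0" "i < n" for i
    proof -
      have "\<sigma> i = level q j i"
      proof (cases "Suc i = n")
        case True
        with that have "level q j (Suc i) = 0" by metis
        then have "q (j + i) / level q j i = 1" by simp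
        then show ?thesis using True that(1,3) pos[of i] by (simp add: \<sigma>_def field_simps)
      qed (use that in \<open>simp add: \<sigma>_def\<close>)
      moreover have "\<tau> (Suc i) = level q j (Suc i)"
        using that by (cases "Suc i = n") (auto simp: \<tau>_def simp del: level.simps)
      ultimately show ?thesis using A(2)[OF that(3)] by simp
    qed
  qed
qed

lemma interior_imp_subcritical:
  assumes n: "2 \<le> n" and int: "p \<in> bigraph_interior (cyclic_bigraph n)"
  shows "subcritical n (cyclic_weight n p)"
proof (rule ccontr)
  let ?q = "cyclic_weight n p"
  assume "\<not> subcritical n ?q"
  then obtain j i where "i \<le> n" and "level ?q j i \<le> 0" by (auto simp: subcritical_def not_less)
  define l where "l = (LEAST i. level ?q j i \<le> 0)"
  have "l \<le> i"
    unfolding l_def using \<open>level ?q j i \<le> 0\<close> by (rule Least_le)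
  then have l: "l \<le> n" using \<open>i \<le> n\<close> by simp
  have npos: "level ?q j l \<le> 0"
    unfolding l_def using \<open>level ?q j i \<le> 0\<close> by (rule LeastI)
  have pos: "0 < level ?q j i" if "i < l" for i
    using not_less_Least[OF that[unfolded l_def]] by simp
  have p: "p \<in> {1..n} \<rightarrow> {0<..<1}" using int by (simp add: bigraph_interior_def)
  obtain A where A: "A \<sim>\<^sub>c cyclic_bigraph n" "\<And>v. v \<in> {1..n} \<Longrightarrow> measure (cube {1..n}) (A v) = p v"
    "(\<Union>v\<in>{1..n}. A v) = {1..n} \<rightarrow>\<^sub>E {0..1}"
    using level_nonpos_family[OF n p l pos npos] by metis
  have "0 < measure (cube {1..n}) (space (cube {1..n}) \<inter> (\<Inter>i\<in>{1..n}. space (cube {1..n}) - A i))"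
    using int A(1,2) unfolding bigraph_interior_def by simp
  moreover have "space (cube {1..n}) \<inter> (\<Inter>i\<in>{1..n}. space (cube {1..n}) - A i) = {}"
    using A(3) by (auto simp: space_cube)
  ultimately show False by simp
qed

lemma staircase_fun_upd:
  assumes "f \<in> staircase I a b s t" "c \<in> I" "x \<in> {0..1}"
    and "c = a \<Longrightarrow> x \<in> upper s" "c = b \<Longrightarrow> x \<notin> upper t"
  shows "f(c := x) \<in> staircase I a b s t"
  using assms PiE_fun_upd[of x "\<lambda>_. {0..1}" c f I] by (auto simp: staircase_def insert_absorb)

theorem theorem11:
  fixes n :: nat and p :: "nat \<Rightarrow> real"
  assumes "n \<ge> 3"
    and "p \<in> bigraph_boundary (cyclic_bigraph n)"
  shows "\<exists>(d :: nat \<Rightarrow> nat) A.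
     (\<forall>j\<in>{1..n}. 0 < d j \<and> d j \<le> 2) \<and> (\<exists>j\<in>{1..n}. d j = 1) \<and>
     A \<sim>\<^sub>c cyclic_bigraph n \<and> discrete_family (cyclic_bigraph n) d A \<and>
     (\<forall>i\<in>{1..n}. measure (bicube (cyclic_bigraph n)) (A i) = p i) \<and>
     measure (bicube (cyclic_bigraph n)) (\<Union>i\<in>{1..n}. A i) = 1"
proof -
  let ?q = "cyclic_weight n p"
  have n: "2 \<le> n" "0 < n" using assms(1) by auto
  have p: "p \<in> {1..n} \<rightarrow> {0<..1}"
    and below: "\<And>\<epsilon>. 0 < \<epsilon> \<Longrightarrow> \<epsilon> < 1 \<Longrightarrow> (\<lambda>i. (1 - \<epsilon>) * p i) \<in> bigraph_interior (cyclic_bigraph n)"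
    and above: "\<And>\<epsilon>. 0 < \<epsilon> \<Longrightarrow> \<epsilon> < 1 \<Longrightarrow> (\<lambda>i. (1 + \<epsilon>) * p i) \<notin> bigraph_interior (cyclic_bigraph n)"
    using assms(2) by (auto simp: bigraph_boundary_def)
  have q: "0 < ?q i" for i using cyclic_weight_mem[OF p n(2), of i] by simp
  have scale: "cyclic_weight n (\<lambda>i. r * p i) = (\<lambda>i. r * ?q i)" for r
    by (simp add: cyclic_weight_def fun_eq_iff)
  have sub: "subcritical n (\<lambda>i. r * ?q i)" if "0 < r" "r < 1" for r
    using interior_imp_subcritical[OF n(1) below[of "1 - r"]] that by (simp add: scale)
  note lev = subcritical_limit[OF q sub]
  \<comment> \<open>Boundary vectors may a priori have entries equal to 1; positivity of level 1 at
    each cut rules them out.\<close>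
  have p1: "p \<in> {1..n} \<rightarrow> {0<..<1}"
  proof
    fix v assume v: "v \<in> {1..n}"
    then have "?q (v - 1) = p v" by (auto simp: cyclic_weight_def)
    then show "p v \<in> {0<..<1}"
      using lev(1)[of 1 "v - 1"] assms(1) p v by auto
  qed
  have "\<exists>j. level ?q j n = 0"
  proof (rule ccontr)
    assume no: "\<not> ?thesis"
    have "subcritical n ?q"
      unfolding subcritical_def
    proof safe
      fix j i assume "i \<le> n"
      then show "0 < level ?q j i" using lev(1)[of i j] lev(2)[of j] no by (metis less_le le_neq_implies_less)
    qed
    then obtain \<epsilon> where e: "0 < \<epsilon>" "\<epsilon> < 1" "subcritical n (\<lambda>i. (1 + \<epsilon>) * ?q i)"
      using subcritical_open[of ?q n] cyclic_weight_periodic n(2) by blast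
    have "(\<lambda>i. (1 + \<epsilon>) * p i) \<in> {1..n} \<rightarrow> {0<..<1}"
    proof
      fix v assume v: "v \<in> {1..n}"
      then have "?q (v - 1) = p v" by (auto simp: cyclic_weight_def)
      moreover have "0 < level (\<lambda>i. (1 + \<epsilon>) * ?q i) (v - 1) 1"
        using e(3) n unfolding subcritical_def by (metis One_nat_def Suc_leI)
      moreover have "0 < (1 + \<epsilon>) * p v" using p v e(1) by (intro mult_pos_pos) auto
      ultimately show "(1 + \<epsilon>) * p v \<in> {0<..<1}" by simp
    qed
    then have "(\<lambda>i. (1 + \<epsilon>) * p i) \<in> bigraph_interior (cyclic_bigraph n)"
      using e(3) assms(1) by (intro subcritical_imp_interior) (auto simp: scale)
    then show False using above[OF e(1,2)] by blast
  qed
  then obtain j where j: "level ?q j n = 0" by blast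
  let ?r = "rotation n j"
  obtain A where A: "A \<sim>\<^sub>c cyclic_bigraph n" "\<And>v. v \<in> {1..n} \<Longrightarrow> measure (cube {1..n}) (A v) = p v"
    "(\<Union>v\<in>{1..n}. A v) = {1..n} \<rightarrow>\<^sub>E {0..1}"
    "\<And>i. i < n \<Longrightarrow> A (?r i) = staircase {1..n} (?r i) (?r (Suc i)) (level ?q j i) (level ?q j (Suc i))"
    using level_nonpos_family[OF n(1) p1 order_refl, of j thesis] lev(1) j by auto
  have bij: "bij_betw ?r {..<n} {1..n}" using bij_rotation[OF n(2)] .
  have onto: "\<exists>i<n. v = ?r i" if "v \<in> {1..n}" for v
    using bij that unfolding bij_betw_def by (metis imageE lessThan_iff)
  have inj: "i = i'" if "?r i = ?r i'" "i < n" "i' < n" for i i'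
    using bij that unfolding bij_betw_def by (meson inj_onD lessThan_iff)
  have rot: "?r i \<in> {1..n}" if "i < n" for i using bij_betwE[OF bij] that by blast
  \<comment> \<open>At the cut the outgoing event uses \<open>upper 1\<close>, everything, and the
    incoming one \<open>upper 0\<close>, nothing, so no event depends on this coordinate. Any other
    coordinate is seen by both of its events only through the same set
    \<open>upper (level ?q j i)\<close>.\<close>
  define d :: "nat \<Rightarrow> nat" where "d v = (if v = ?r 0 then 1 else 2)" for v
  have "discrete_in_dim n (d c) c (A v)" if vc: "v \<in> {1..n}" "c \<in> {1..n}" for v c
  proof -
    obtain i i' where i: "i < n" "v = ?r i" "i' < n" "c = ?r i'" using onto vc by blast
    have sub: "A v \<subseteq> {1..n} \<rightarrow>\<^sub>E {0..1}" using A(3) vc by blast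
    have last: "?r (Suc i) = c \<longleftrightarrow> Suc i = i' \<or> (Suc i = n \<and> i' = 0)"
      using inj[of "Suc i" i'] inj[of 0 i'] rotation_full[of n j] i n
      by (cases "Suc i = n") (auto simp: less_Suc_eq)
    have upd: "f(c := x) \<in> A v" if "f \<in> A v" "x \<in> {0..1}" "i = i' \<Longrightarrow> x \<in> upper (level ?q j i)"
      "?r (Suc i) = c \<Longrightarrow> x \<notin> upper (level ?q j (Suc i))" for f x
      unfolding i(2) A(4)[OF i(1)]
    proof (rule staircase_fun_upd)
      show "f \<in> staircase {1..n} (?r i) (?r (Suc i)) (level ?q j i) (level ?q j (Suc i))"
        using that(1) unfolding i(2) A(4)[OF i(1)] .
      show "x \<in> upper (level ?q j i)" if "c = ?r i"
        using that i inj[of i i'] \<open>i = i' \<Longrightarrow> x \<in> upper (level ?q j i)\<close> by metis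
    qed (use that vc(2) in metis)+
    show ?thesis
    proof (cases "i' = 0")
      case True
      show ?thesis
      proof -
        have "discrete_in_dim n 1 c (A v)"
        proof (rule discrete_in_dim_one[OF sub vc(2)])
          fix f x assume f: "f \<in> A v" "x \<in> {0..1::real}"
          then show "f(c := x) \<in> A v"
          proof (rule upd)
            show "x \<in> upper (level ?q j i)" if "i = i'" using that True f(2) by simp
            show "x \<notin> upper (level ?q j (Suc i))" if "?r (Suc i) = c"
            proof -
              have "Suc i = n" using that last True by simp
              then have "level ?q j (Suc i) = 0" using j by (simp only:)
              then show ?thesis by (simp only: upper_simps) simp
            qed
          qed
        qed
        then show ?thesis using i(4) True by (simp add: d_def)
      qed
    next
      case False
      then obtain m where m: "i' = Suc m" by (cases i') auto
      have "c \<noteq> ?r 0" using inj[of i' 0] i n False by auto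
      moreover have "discrete_in_dim n 2 c (A v)"
      proof (rule discrete_in_dim_two[OF sub vc(2), of "level ?q j i'"])
        show "0 < level ?q j i'" using lev(1) i by blast
        show "level ?q j i' < 1" using lev(1)[of m j] q[of "j + m"] i m by simp
        fix f x assume f: "f \<in> A v" "x \<in> {0..1}" "f c \<in> upper (level ?q j i') \<longleftrightarrow> x \<in> upper (level ?q j i')"
        have fA: "f (?r i) \<in> upper (level ?q j i)" "f (?r (Suc i)) \<notin> upper (level ?q j (Suc i))"
          using f(1) unfolding i(2) A(4)[OF i(1)] by (auto simp: staircase_def)
        show "f(c := x) \<in> A v"
        proof (rule upd[OF f(1,2)])
          show "x \<in> upper (level ?q j i)" if "i = i'"
            using that fA(1) f(3) i(4) by metis
          show "x \<notin> upper (level ?q j (Suc i))" if "?r (Suc i) = c"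
            using that fA(2) f(3) last False by metis
        qed
      qed
      ultimately show ?thesis by (simp add: d_def)
    qed
  qed
  then have "discrete_family (cyclic_bigraph n) d A"
    by (simp add: discrete_family_def discrete_set_def)
  moreover have "measure (cube {1..n}) (\<Union>v\<in>{1..n}. A v) = 1"
    using prob_space.prob_space[OF prob_space_cube, of "{1..n}"] A(3) by (simp add: space_cube)
  moreover have "\<forall>v\<in>{1..n}. 0 < d v \<and> d v \<le> 2" "\<exists>v\<in>{1..n}. d v = 1"
    using rot[OF n(2)] by (auto simp: d_def)
  ultimately show ?thesis
    unfolding cyclic_bigraph_sel using A(1,2) by (intro exI[of _ d] exI[of _ A]) blast
qed

end
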